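(* Let $M$ be an arbitrary connected $n$-dimensional Riemannian manifold, and let $\rho$ be the distance function on $M$ generated by the Riemannian metric. Then the Steiner ratio of $M$ does not exceed the Steiner ratio of the Euclidean space $\mathbb{R}^n$, that is, $m(M,\rho)\le m(\mathbb{R}^n)$.
   Context: For a metric space $(X,\rho)$ and a finite nonempty subset $N\subset X$, $\rho(\mathrm{MST}_N)$ denotes the least weight of a spanning tree of the complete graph on $N$, where the edge $xy$ has weight $\rho(x,y)$ and the weight of a graph is the sum of the weights of its edges. Further, $\rho(\mathrm{SMT}_N)=\inf\rho(\mathrm{MST}_{\bar N})$, the infimum being over all finite subsets $\bar N\subset X$ with $\bar N\supset N$ (whether or not it is attained). The Steiner ratio of $(X,\rho)$ (a space with at least two points) is $m(X,\rho)=\inf_N \rho(\mathrm{SMT}_N)/\rho(\mathrm{MST}_N)$, the infimum being over all finite subsets $N\subset X$ with at least two points. For a connected Riemannian manifold, the distance generated by the Riemannian metric is $\rho(x,y)=\inf_\gamma \operatorname{len}(\gamma)$ over piecewise-smooth curves $\gamma$ joining $x$ and $y$. $m(\mathbb{R}^n)$ is the Steiner ratio of $\mathbb{R}^n$ with the Euclidean distance; $n\ge 1$. *)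

theory Defs
  imports "HOL-Analysis.Analysis"
begin

section \<open>Spanning trees and the Steiner ratio\<close>

text \<open>An undirected simple graph is its adjacency relation, a symmetric irreflexive set of ordered
  pairs; an edge \<open>xy\<close> is thus present as both \<open>(x, y)\<close> and \<open>(y, x)\<close>.\<close>

definition is_cycle :: "('a \<times> 'a) set \<Rightarrow> 'a list \<Rightarrow> bool" where
  "is_cycle E vs \<longleftrightarrow> 3 \<le> length vs \<and> distinct vs \<and>
     (\<forall>i. Suc i < length vs \<longrightarrow> (vs ! i, vs ! Suc i) \<in> E) \<and> (last vs, hd vs) \<in> E"

definition spanning_tree :: "'a set \<Rightarrow> ('a \<times> 'a) set \<Rightarrow> bool" where
  "spanning_tree N E \<longleftrightarrow> E \<subseteq> N \<times> N \<and> sym E \<and> irrefl E \<and>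
     (\<forall>x\<in>N. \<forall>y\<in>N. (x, y) \<in> E\<^sup>*) \<and> (\<nexists>vs. is_cycle E vs)"

text \<open>The factor \<open>1/2\<close> compensates for each edge occurring as two ordered pairs.\<close>

definition graph_weight :: "('a \<Rightarrow> 'a \<Rightarrow> real) \<Rightarrow> ('a \<times> 'a) set \<Rightarrow> real" where
  "graph_weight \<rho> E = (\<Sum>(x, y)\<in>E. \<rho> x y) / 2"

definition mst_weight :: "('a \<Rightarrow> 'a \<Rightarrow> real) \<Rightarrow> 'a set \<Rightarrow> real" where
  "mst_weight \<rho> N = Min (graph_weight \<rho> ` {E. spanning_tree N E})"

definition smt_weight :: "'a set \<Rightarrow> ('a \<Rightarrow> 'a \<Rightarrow> real) \<Rightarrow> 'a set \<Rightarrow> real" where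
  "smt_weight X \<rho> N = Inf (mst_weight \<rho> ` {N'. finite N' \<and> N \<subseteq> N' \<and> N' \<subseteq> X})"

definition steiner_ratio :: "'a set \<Rightarrow> ('a \<Rightarrow> 'a \<Rightarrow> real) \<Rightarrow> real" where
  "steiner_ratio X \<rho> =
     Inf {smt_weight X \<rho> N / mst_weight \<rho> N | N. finite N \<and> N \<subseteq> X \<and> 2 \<le> card N}"

section \<open>Riemannian manifolds\<close>

text \<open>\<open>Ck_on k f S\<close> and \<open>smooth_on f S\<close> are meant for open \<open>S\<close> only: they use two-sided derivatives.\<close>

primrec Ck_on :: "nat \<Rightarrow> ('a::euclidean_space \<Rightarrow> 'b::euclidean_space) \<Rightarrow> 'a set \<Rightarrow> bool" where
  "Ck_on 0 f S \<longleftrightarrow> continuous_on S f"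
| "Ck_on (Suc k) f S \<longleftrightarrow> (\<forall>x\<in>S. f differentiable (at x)) \<and>
     (\<forall>v. Ck_on k (\<lambda>x. frechet_derivative f (at x) v) S)"

definition smooth_on :: "('a::euclidean_space \<Rightarrow> 'b::euclidean_space) \<Rightarrow> 'a set \<Rightarrow> bool" where
  "smooth_on f S \<longleftrightarrow> (\<forall>k. Ck_on k f S)"

text \<open>A chart is a pair of its domain and its coordinate map; the values of the coordinate map
  outside the domain are irrelevant.\<close>

type_synonym ('a, 'n) chart = "'a set \<times> ('a \<Rightarrow> real ^ 'n)"

definition chart_of :: "'a topology \<Rightarrow> ('a, 'n::finite) chart \<Rightarrow> bool" where
  "chart_of T c \<longleftrightarrow> (case c of (U, \<phi>) \<Rightarrow>
     openin T U \<and> open (\<phi> ` U) \<and>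
     homeomorphic_map (subtopology T U) (top_of_set (\<phi> ` U)) \<phi>)"

definition transition :: "('a, 'n::finite) chart \<Rightarrow> ('a, 'n) chart \<Rightarrow> real ^ 'n \<Rightarrow> real ^ 'n" where
  "transition c d = snd d \<circ> inv_into (fst c) (snd c)"

locale smooth_manifold =
  fixes T :: "'a topology" and A :: "('a, 'n::finite) chart set"
  assumes nonempty: "topspace T \<noteq> {}"
    and Hausdorff: "Hausdorff_space T"
    and second_countable: "second_countable T"
    and chart: "c \<in> A \<Longrightarrow> chart_of T c"
    and cover: "topspace T = (\<Union>c\<in>A. fst c)"
    and smooth_transition: "\<lbrakk>c \<in> A; d \<in> A\<rbrakk> \<Longrightarrow>
      smooth_on (transition c d) (snd c ` (fst c \<inter> fst d))"

text \<open>The Riemannian metric is a smooth positive definite symmetric (0,2)-tensor field given in local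
  coordinates: \<open>g c p u v\<close> is the inner product at \<open>p\<close> of the tangent vectors with coordinates
  \<open>u\<close> and \<open>v\<close> in the chart \<open>c\<close>.\<close>

locale riemannian_manifold = smooth_manifold T A
  for T :: "'a topology" and A :: "('a, 'n::finite) chart set" +
  fixes g :: "('a, 'n) chart \<Rightarrow> 'a \<Rightarrow> real ^ 'n \<Rightarrow> real ^ 'n \<Rightarrow> real"
  assumes metric_bilinear: "\<lbrakk>c \<in> A; p \<in> fst c\<rbrakk> \<Longrightarrow> bilinear (g c p)"
    and metric_sym: "\<lbrakk>c \<in> A; p \<in> fst c\<rbrakk> \<Longrightarrow> g c p u v = g c p v u"
    and metric_pos: "\<lbrakk>c \<in> A; p \<in> fst c; v \<noteq> 0\<rbrakk> \<Longrightarrow> 0 < g c p v v"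
    and metric_smooth: "c \<in> A \<Longrightarrow>
      smooth_on (\<lambda>x. g c (inv_into (fst c) (snd c) x) u v) (snd c ` fst c)"
    and metric_transform: "\<lbrakk>c \<in> A; d \<in> A; p \<in> fst c; p \<in> fst d\<rbrakk> \<Longrightarrow>
      g c p u v = g d p (frechet_derivative (transition c d) (at (snd c p)) u)
                        (frechet_derivative (transition c d) (at (snd c p)) v)"

section \<open>Length of curves and the Riemannian distance\<close>

text \<open>A curve is smooth on a closed interval if it extends to a smooth curve on a larger open
  interval.\<close>

definition smooth_curve_on ::
    "'a topology \<Rightarrow> ('a, 'n::finite) chart set \<Rightarrow> (real \<Rightarrow> 'a) \<Rightarrow> real \<Rightarrow> real \<Rightarrow> bool" where
  "smooth_curve_on T A \<gamma> s t \<longleftrightarrow> (\<exists>\<delta> \<epsilon>. 0 < \<epsilon> \<and> (\<forall>r\<in>{s..t}. \<delta> r = \<gamma> r) \<and>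
     continuous_map (top_of_set {s - \<epsilon><..<t + \<epsilon>}) T \<delta> \<and>
     (\<forall>(U, \<phi>)\<in>A. smooth_on (\<phi> \<circ> \<delta>) {r \<in> {s - \<epsilon><..<t + \<epsilon>}. \<delta> r \<in> U}))"

text \<open>Continuity at the break points is implied, as adjacent pieces share their end point.\<close>

definition piecewise_smooth_curve ::
    "'a topology \<Rightarrow> ('a, 'n::finite) chart set \<Rightarrow> (real \<Rightarrow> 'a) \<Rightarrow> real \<Rightarrow> real \<Rightarrow> bool" where
  "piecewise_smooth_curve T A \<gamma> a b \<longleftrightarrow> (\<exists>(k::nat) \<tau>. \<tau> 0 = a \<and> \<tau> k = b \<and>
     (\<forall>i<k. \<tau> i < \<tau> (Suc i) \<and> smooth_curve_on T A \<gamma> (\<tau> i) (\<tau> (Suc i))))"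

text \<open>The speed does not depend on the chosen chart, by the transformation law of the metric. At a
  break point the value is arbitrary, which does not affect the length.\<close>

definition speed ::
    "('a, 'n::finite) chart set \<Rightarrow> (('a, 'n) chart \<Rightarrow> 'a \<Rightarrow> real ^ 'n \<Rightarrow> real ^ 'n \<Rightarrow> real) \<Rightarrow>
     (real \<Rightarrow> 'a) \<Rightarrow> real \<Rightarrow> real" where
  "speed A g \<gamma> t = (let c = (SOME c. c \<in> A \<and> \<gamma> t \<in> fst c);
                        v = vector_derivative (snd c \<circ> \<gamma>) (at t)
                    in sqrt (g c (\<gamma> t) v v))"

definition curve_length ::
    "('a, 'n::finite) chart set \<Rightarrow> (('a, 'n) chart \<Rightarrow> 'a \<Rightarrow> real ^ 'n \<Rightarrow> real ^ 'n \<Rightarrow> real) \<Rightarrow>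
     (real \<Rightarrow> 'a) \<Rightarrow> real \<Rightarrow> real \<Rightarrow> real" where
  "curve_length A g \<gamma> a b = integral {a..b} (speed A g \<gamma>)"

definition riemannian_dist ::
    "'a topology \<Rightarrow> ('a, 'n::finite) chart set \<Rightarrow>
     (('a, 'n) chart \<Rightarrow> 'a \<Rightarrow> real ^ 'n \<Rightarrow> real ^ 'n \<Rightarrow> real) \<Rightarrow> 'a \<Rightarrow> 'a \<Rightarrow> real" where
  "riemannian_dist T A g x y = Inf {curve_length A g \<gamma> a b | \<gamma> a b.
     a < b \<and> \<gamma> a = x \<and> \<gamma> b = y \<and> piecewise_smooth_curve T A \<gamma> a b}"

end

(*
  On a small ball, the distance of M is, up to a factor arbitrarily close to 1, the Euclidean distance
  in linear coordinates that are orthonormal at the centre. Given finite N and N' with N contained in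
  N' in R^n, shrink N' by a homothety until it fits into such a ball and transport it to M: all
  pairwise distances are multiplied by nearly the same constant, so the minimal spanning trees of N
  and of N' are, too, and the quotient of their weights is almost preserved. Steiner points of M
  outside the ball can only decrease the ratio on M, which is the direction claimed.
  Connectedness is needed because the distance of two points that no curve joins is the junk value
  Inf {}, which may be negative and spoil the lower bounds of the infima.
*)
theory Submission
  imports Defs
begin

section \<open>Spanning trees under injections\<close>

text \<open>Continuity of the metric coefficients at one point already makes the metric
  \<open>K\<close>-close to a constant one on a small ball. The obstacle is the lower bound for
  distances, since a curve may leave the chart. It is followed only until it first leaves the
  Euclidean ball of radius \<open>dist x y\<close> about \<open>x\<close>, by which time it has
  covered that Euclidean distance; taking the points within a fifth of the chart radius keeps this
  ball inside the chart. Squared norms are compared up to \<open>K\<close> in either direction,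
  hence lengths up to \<open>sqrt K\<close> in either direction, and the distances up to
  \<open>K\<close> after rescaling. For a fixed pair of finite sets \<open>K\<close> tends to 1 at
  the end, with a new copy for every \<open>K\<close>, so the infima need not be attained. Curves
  map into an abstract topological space; their continuity is used through preimages of closed sets,
  and compactness with the Hausdorff property supplies those sets.\<close>

lemma is_cycle_map:
  assumes "is_cycle E vs" "\<And>x y. (x, y) \<in> E \<Longrightarrow> (h x, h y) \<in> E'" "inj_on h (Field E)"
  shows "is_cycle E' (map h vs)"
proof -
  \<comment> \<open>Injectivity is given on \<open>Field E\<close> only, so every vertex needs an
    edge: the one to its successor, or for the last vertex the closing edge.\<close>
  have "x \<in> Field E" if "x \<in> set vs" for x
  proof -
    obtain i where i: "i < length vs" "x = vs ! i"
      using \<open>x \<in> set vs\<close> by (metis in_set_conv_nth)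
    show ?thesis
    proof (cases "Suc i < length vs")
      case True
      then show ?thesis
        using assms(1) i unfolding is_cycle_def by (auto simp: Field_def)
    next
      case False
      then have "x = last vs"
        using i by (metis Suc_lessI diff_Suc_1 last_conv_nth length_0_conv not_less_zero)
      then show ?thesis
        using assms(1) unfolding is_cycle_def by (auto simp: Field_def)
    qed
  qed
  then have "inj_on h (set vs)"
    using assms(3) inj_on_subset by blast
  moreover have "vs \<noteq> []"
    using assms(1) unfolding is_cycle_def by auto
  ultimately show ?thesis
    using assms(1,2) unfolding is_cycle_def
    by (simp add: distinct_map last_map hd_map)
qed

text \<open>Paths are pushed forward along \<open>f\<close>; for acyclicity a cycle of the image is
  pulled back along \<open>inv_into N f\<close>.\<close>

lemma spanning_tree_image:
  assumes "inj_on f N" "spanning_tree N E"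
  shows "spanning_tree (f ` N) (map_prod f f ` E)"
proof -
  have EN: "E \<subseteq> N \<times> N" and "sym E" and "irrefl E"
    and conn: "\<And>x y. x \<in> N \<Longrightarrow> y \<in> N \<Longrightarrow> (x, y) \<in> E\<^sup>*"
    and acyclic: "\<nexists>vs. is_cycle E vs"
    using assms(2) by (auto simp: spanning_tree_def)
  let ?E = "map_prod f f ` E"
  have sub: "?E \<subseteq> f ` N \<times> f ` N"
    using EN by auto
  have "sym ?E"
    using \<open>sym E\<close> by (auto simp: sym_def)
  moreover have "irrefl ?E"
    using \<open>irrefl E\<close> EN assms(1) by (fastforce simp: irrefl_def inj_on_def)
  moreover have "(f x, f y) \<in> ?E\<^sup>*" if "(x, y) \<in> E\<^sup>*" for x y
    using that
  proof induction
    case (step y z)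
    then have "(f y, f z) \<in> ?E" by force
    with step.IH show ?case by (rule rtrancl_into_rtrancl)
  qed simp
  moreover have "\<not> is_cycle ?E ws" for ws
  proof
    assume *: "is_cycle ?E ws"
    have "(inv_into N f x, inv_into N f y) \<in> E" if "(x, y) \<in> ?E" for x y
      using that EN assms(1) by (auto simp: inv_into_f_f)
    moreover have "inj_on (inv_into N f) (Field ?E)"
      using sub by (intro inj_on_inv_into) (auto simp: Field_def)
    ultimately have "is_cycle E (map (inv_into N f) ws)"
      using is_cycle_map[OF *] by blast
    then show False using acyclic by blast
  qed
  ultimately show ?thesis
    using sub conn unfolding spanning_tree_def by (auto simp del: map_prod_simp)
qed

text \<open>The star about any point is a spanning tree. This makes the set under \<open>Min\<close>
  in \<open>mst_weight\<close> nonempty.\<close>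

lemma ex_spanning_tree: "\<exists>E. spanning_tree N E"
proof (cases "N = {}")
  case True
  have "\<not> is_cycle {} vs" for vs :: "'a list"
    by (simp add: is_cycle_def)
  then have "spanning_tree N {}"
    using True by (auto simp: spanning_tree_def sym_def irrefl_def)
  then show ?thesis ..
next
  case False
  then obtain c where "c \<in> N" by blast
  let ?E = "{c} \<times> (N - {c}) \<union> (N - {c}) \<times> {c}"
  have "(x, y) \<in> ?E\<^sup>*" if "x \<in> N" "y \<in> N" for x y
  proof -
    have "(x, c) \<in> ?E\<^sup>*"
      using that by (cases "x = c") auto
    moreover have "(c, y) \<in> ?E\<^sup>*"
      using that by (cases "y = c") auto
    ultimately show ?thesis by simp
  qed
  moreover have "\<not> is_cycle ?E vs" for vs
  proof
    assume cyc: "is_cycle ?E vs"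
    then have len: "3 \<le> length vs" and dist: "distinct vs"
      and step: "\<And>i. Suc i < length vs \<Longrightarrow> (vs ! i, vs ! Suc i) \<in> ?E"
      and close: "(last vs, hd vs) \<in> ?E"
      unfolding is_cycle_def by blast+
    have "vs \<noteq> []"
      using len by auto
    then have neq: "vs ! 0 \<noteq> vs ! 1" "vs ! 1 \<noteq> vs ! 2" "vs ! 0 \<noteq> vs ! 2"
      using nth_eq_iff_index_eq[OF dist, of 0 1] nth_eq_iff_index_eq[OF dist, of 1 2]
        nth_eq_iff_index_eq[OF dist, of 0 2] len by auto
    have "(vs ! 0, vs ! 1) \<in> ?E" "(vs ! 1, vs ! 2) \<in> ?E"
      using step[of 0] step[of 1] len by (auto simp: numeral_2_eq_2)
    \<comment> \<open>Both edges contain the centre, and \<open>vs ! 1\<close> is the only vertex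
      that they share.\<close>
    with neq have c: "c = vs ! 1" by auto
    \<comment> \<open>The next edge leaves \<open>vs ! 2\<close> and avoids the centre: it is the
      closing edge if the cycle has three vertices, otherwise the edge to
      \<open>vs ! 3\<close>.\<close>
    show False
    proof (cases "length vs = 3")
      case True
      then have "last vs = vs ! 2" "hd vs = vs ! 0"
        using len by (simp_all add: last_conv_nth hd_conv_nth flip: length_greater_0_conv)
      with close neq c show False by auto
    next
      case False
      then have "(vs ! 2, vs ! 3) \<in> ?E" "vs ! 3 \<noteq> vs ! 1"
        using step[of 2] len dist by (auto simp: nth_eq_iff_index_eq numeral_3_eq_3 numeral_2_eq_2)
      with neq c show False by auto
    qed
  qed
  ultimately have "spanning_tree N ?E"
    using \<open>c \<in> N\<close> unfolding spanning_tree_def by (auto simp: sym_def irrefl_def)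
  then show ?thesis ..
qed

section \<open>Least weights and their behaviour under injections\<close>

lemma finite_spanning_trees:
  assumes "finite N"
  shows "finite {E. spanning_tree N E}"
  by (rule finite_subset[of _ "Pow (N \<times> N)"]) (auto simp: spanning_tree_def assms)

lemma mst_weight_le:
  "finite N \<Longrightarrow> spanning_tree N E \<Longrightarrow> mst_weight \<rho> N \<le> graph_weight \<rho> E"
  unfolding mst_weight_def using finite_spanning_trees by (intro Min_le) auto

lemma mst_weight_attained:
  assumes "finite N"
  obtains E where "spanning_tree N E" "mst_weight \<rho> N = graph_weight \<rho> E"
proof -
  have "mst_weight \<rho> N \<in> graph_weight \<rho> ` {E. spanning_tree N E}"
    unfolding mst_weight_def using finite_spanning_trees[OF assms] ex_spanning_tree
    by (intro Min_in) auto
  then show thesis using that by auto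
qed

lemma mst_weight_nonneg:
  assumes "finite N" "\<And>x y. x \<in> N \<Longrightarrow> y \<in> N \<Longrightarrow> 0 \<le> \<rho> x y"
  shows "0 \<le> mst_weight \<rho> N"
proof -
  obtain E where E: "spanning_tree N E" "mst_weight \<rho> N = graph_weight \<rho> E"
    using mst_weight_attained[OF assms(1)] .
  then have "E \<subseteq> N \<times> N"
    by (simp add: spanning_tree_def)
  then have "0 \<le> (\<Sum>(x, y)\<in>E. \<rho> x y)"
    using assms(2) by (intro sum_nonneg) auto
  then show ?thesis
    unfolding E(2) graph_weight_def by simp
qed

text \<open>A minimal tree for \<open>\<sigma>\<close> is carried along \<open>f\<close> to a
  competitor on the image, edge by edge.\<close>

lemma mst_weight_image_le:
  assumes "finite N" "inj_on f N"
    and le: "\<And>x y. x \<in> N \<Longrightarrow> y \<in> N \<Longrightarrow> \<rho> (f x) (f y) \<le> C * \<sigma> x y"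
  shows "mst_weight \<rho> (f ` N) \<le> C * mst_weight \<sigma> N"
proof -
  obtain E where E: "spanning_tree N E" "mst_weight \<sigma> N = graph_weight \<sigma> E"
    using mst_weight_attained[OF assms(1)] .
  have EN: "E \<subseteq> N \<times> N"
    using E(1) by (simp add: spanning_tree_def)
  then have inj: "inj_on (map_prod f f) E"
    using map_prod_inj_on[OF assms(2,2)] inj_on_subset by blast
  have "mst_weight \<rho> (f ` N) \<le> graph_weight \<rho> (map_prod f f ` E)"
    using assms(1) spanning_tree_image[OF assms(2) E(1)] by (intro mst_weight_le) auto
  also have "\<dots> = (\<Sum>(x, y)\<in>E. \<rho> (f x) (f y)) / 2"
    unfolding graph_weight_def by (subst sum.reindex[OF inj]) (simp add: case_prod_unfold)
  also have "\<dots> \<le> (\<Sum>(x, y)\<in>E. C * \<sigma> x y) / 2"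
    using EN le by (intro divide_right_mono sum_mono) auto
  also have "\<dots> = C * mst_weight \<sigma> N"
    unfolding E(2) graph_weight_def by (simp add: sum_distrib_left case_prod_unfold)
  finally show ?thesis .
qed

lemma mst_weight_image_ge:
  assumes "finite N" "inj_on f N" "0 < t"
    and "\<And>x y. x \<in> N \<Longrightarrow> y \<in> N \<Longrightarrow> t * \<sigma> x y \<le> \<rho> (f x) (f y)"
  shows "t * mst_weight \<sigma> N \<le> mst_weight \<rho> (f ` N)"
proof -
  \<comment> \<open>The upper estimate is applied to the inverse of \<open>f\<close>, with
    \<open>1 / t\<close> in the role of \<open>C\<close>.\<close>
  have "mst_weight \<sigma> (inv_into N f ` f ` N) \<le> (1 / t) * mst_weight \<rho> (f ` N)"
    using assms by (intro mst_weight_image_le) (auto simp: inj_on_inv_into field_simps)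
  then show ?thesis
    using assms(2,3) by (simp add: field_simps)
qed

text \<open>Nonnegative distances bound the weights below, so that \<open>Inf\<close> is a genuine
  lower bound.\<close>

lemma smt_weight_le:
  assumes "\<And>x y. x \<in> X \<Longrightarrow> y \<in> X \<Longrightarrow> 0 \<le> \<rho> x y"
    and "finite N'" "N \<subseteq> N'" "N' \<subseteq> X"
  shows "smt_weight X \<rho> N \<le> mst_weight \<rho> N'"
  unfolding smt_weight_def
proof (rule cInf_lower)
  show "bdd_below (mst_weight \<rho> ` {N'. finite N' \<and> N \<subseteq> N' \<and> N' \<subseteq> X})"
    using assms(1) by (intro bdd_belowI[of _ 0]) (auto intro!: mst_weight_nonneg)
qed (use assms in blast)

lemma smt_weight_greatest:
  assumes "finite N" "N \<subseteq> X"
    and "\<And>N'. finite N' \<Longrightarrow> N \<subseteq> N' \<Longrightarrow> N' \<subseteq> X \<Longrightarrow> c \<le> mst_weight \<rho> N'"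
  shows "c \<le> smt_weight X \<rho> N"
  unfolding smt_weight_def using assms by (intro cInf_greatest) auto

lemma steiner_ratio_le:
  assumes nonneg: "\<And>x y. x \<in> X \<Longrightarrow> y \<in> X \<Longrightarrow> 0 \<le> \<rho> x y"
    and "finite N" "N \<subseteq> X" "2 \<le> card N"
  shows "steiner_ratio X \<rho> \<le> smt_weight X \<rho> N / mst_weight \<rho> N"
  unfolding steiner_ratio_def
proof (rule cInf_lower)
  have "0 \<le> smt_weight X \<rho> N / mst_weight \<rho> N" if "finite N" "N \<subseteq> X" for N
    using that nonneg
    by (intro divide_nonneg_nonneg smt_weight_greatest mst_weight_nonneg) blast+
  then show "bdd_below {smt_weight X \<rho> N / mst_weight \<rho> N |N. finite N \<and> N \<subseteq> X \<and> 2 \<le> card N}"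
    by (intro bdd_belowI[of _ 0]) auto
qed (use assms in blast)

section \<open>Approximately similar copies\<close>

text \<open>Each comparison involves only finitely many points, so the copy \<open>f\<close> may
  depend on \<open>S\<close> and \<open>K\<close>. The scale \<open>t\<close> is arbitrary because
  the quotient of two weights is invariant under scaling.\<close>

lemma steiner_ratio_mono_approx_similar:
  assumes nonneg_X: "\<And>x y. x \<in> X \<Longrightarrow> y \<in> X \<Longrightarrow> 0 \<le> \<rho> x y"
    and nonneg_Y: "\<And>x y. x \<in> Y \<Longrightarrow> y \<in> Y \<Longrightarrow> 0 \<le> \<sigma> x y"
    and nontrivial: "\<exists>N. finite N \<and> N \<subseteq> Y \<and> 2 \<le> card N"
    and similar: "\<And>S K. finite S \<Longrightarrow> S \<subseteq> Y \<Longrightarrow> 1 < K \<Longrightarrow>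
      \<exists>f t. 0 < t \<and> inj_on f S \<and> f ` S \<subseteq> X \<and>
        (\<forall>x\<in>S. \<forall>y\<in>S. t * \<sigma> x y \<le> \<rho> (f x) (f y) \<and> \<rho> (f x) (f y) \<le> K * t * \<sigma> x y)"
  shows "steiner_ratio X \<rho> \<le> steiner_ratio Y \<sigma>"
proof -
  let ?s = "steiner_ratio X \<rho>"
  \<comment> \<open>One \<open>f\<close> transports both \<open>N\<close> and \<open>S\<close>: the
    lower estimate is used on \<open>N\<close>, the upper one on \<open>S\<close>, and
    \<open>t\<close> cancels.\<close>
  have key: "?s * mst_weight \<sigma> N \<le> K * mst_weight \<sigma> S"
    if N: "finite N" "2 \<le> card N" and S: "finite S" "N \<subseteq> S" "S \<subseteq> Y" and m: "0 < mst_weight \<sigma> N"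
      and K: "1 < K"
    for N S K
  proof -
    obtain f t where t: "0 < t" and f: "inj_on f S" "f ` S \<subseteq> X"
      and lo: "\<And>x y. x \<in> S \<Longrightarrow> y \<in> S \<Longrightarrow> t * \<sigma> x y \<le> \<rho> (f x) (f y)"
      and up: "\<And>x y. x \<in> S \<Longrightarrow> y \<in> S \<Longrightarrow> \<rho> (f x) (f y) \<le> K * t * \<sigma> x y"
      using similar[OF S(1,3) K] by metis
    have fN: "inj_on f N" "f ` N \<subseteq> X"
      using f S(2) inj_on_subset by blast+
    have lo_N: "t * mst_weight \<sigma> N \<le> mst_weight \<rho> (f ` N)"
      using N(1) fN(1) t lo S(2) by (intro mst_weight_image_ge) auto
    then have pos: "0 < mst_weight \<rho> (f ` N)"
      using t m by (smt (verit) mult_pos_pos)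
    have up_S: "mst_weight \<rho> (f ` S) \<le> K * t * mst_weight \<sigma> S"
      using S(1) f(1) up by (rule mst_weight_image_le)
    have "?s \<le> smt_weight X \<rho> (f ` N) / mst_weight \<rho> (f ` N)"
      using nonneg_X N fN by (intro steiner_ratio_le) (auto simp: card_image)
    then have "?s * mst_weight \<rho> (f ` N) \<le> smt_weight X \<rho> (f ` N)"
      using pos by (simp add: field_simps)
    also have "\<dots> \<le> mst_weight \<rho> (f ` S)"
      using nonneg_X S f(2) by (intro smt_weight_le) auto
    finally have le: "?s * mst_weight \<rho> (f ` N) \<le> K * t * mst_weight \<sigma> S"
      using up_S by linarith
    \<comment> \<open>The lower estimate on \<open>N\<close> may be multiplied by \<open>?s\<close>
      only if \<open>?s\<close> is nonnegative; otherwise the left side is negative and the right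
      side is not.\<close>
    show ?thesis
    proof (cases "0 \<le> ?s")
      case True
      then have "?s * (t * mst_weight \<sigma> N) \<le> K * t * mst_weight \<sigma> S"
        using lo_N le by (smt (verit) mult_left_mono)
      then have "t * (?s * mst_weight \<sigma> N) \<le> t * (K * mst_weight \<sigma> S)"
        by (simp add: mult_ac)
      then show ?thesis using t by simp
    next
      case False
      moreover have "0 \<le> mst_weight \<sigma> S"
        using S by (intro mst_weight_nonneg nonneg_Y) auto
      ultimately show ?thesis
        using m K by (smt (verit) mult_nonneg_nonneg mult_neg_pos)
    qed
  qed
  have "?s \<le> smt_weight Y \<sigma> N / mst_weight \<sigma> N" if N: "finite N" "N \<subseteq> Y" "2 \<le> card N" for N
  proof (cases "mst_weight \<sigma> N = 0")
    \<comment> \<open>\<open>\<sigma>\<close> is merely nonnegative, so the weight may vanish. Then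
      so does the weight of a copy with \<open>K = 2\<close>, and both quotients are
      \<open>0\<close> by the convention for division by zero.\<close>
    case True
    obtain f t where "0 < t" and f: "inj_on f N" "f ` N \<subseteq> X"
      and up: "\<And>x y. x \<in> N \<Longrightarrow> y \<in> N \<Longrightarrow> \<rho> (f x) (f y) \<le> 2 * t * \<sigma> x y"
      using similar[OF N(1,2), of 2] by auto
    have "mst_weight \<rho> (f ` N) \<le> 2 * t * mst_weight \<sigma> N"
      using N(1) f(1) up by (rule mst_weight_image_le)
    moreover have "0 \<le> mst_weight \<rho> (f ` N)"
      using N(1) f by (intro mst_weight_nonneg nonneg_X) auto
    ultimately have "mst_weight \<rho> (f ` N) = 0"
      using True by simp
    moreover have "?s \<le> smt_weight X \<rho> (f ` N) / mst_weight \<rho> (f ` N)"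
      using nonneg_X N f by (intro steiner_ratio_le) (auto simp: card_image)
    ultimately show ?thesis
      using True by simp
  next
    case False
    moreover have "0 \<le> mst_weight \<sigma> N"
      using N by (intro mst_weight_nonneg nonneg_Y) auto
    ultimately have m: "0 < mst_weight \<sigma> N" by simp
    have "?s * mst_weight \<sigma> N \<le> smt_weight Y \<sigma> N"
    proof (rule smt_weight_greatest)
      fix S assume S: "finite S" "N \<subseteq> S" "S \<subseteq> Y"
      show "?s * mst_weight \<sigma> N \<le> mst_weight \<sigma> S"
      proof (rule field_le_epsilon)
        fix e :: real assume e: "0 < e"
        have S0: "0 \<le> mst_weight \<sigma> S"
          using S by (intro mst_weight_nonneg nonneg_Y) auto
        \<comment> \<open>Chosen so that \<open>(?K - 1) * mst_weight \<sigma> S\<close> is at most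
          \<open>e\<close>; the summand 1 keeps the denominator positive.\<close>
        let ?K = "1 + e / (1 + mst_weight \<sigma> S)"
        have "?s * mst_weight \<sigma> N \<le> ?K * mst_weight \<sigma> S"
          using N S m e S0 by (intro key) auto
        also have "\<dots> \<le> mst_weight \<sigma> S + e"
          using e S0 by (simp add: field_simps)
        finally show "?s * mst_weight \<sigma> N \<le> mst_weight \<sigma> S + e" .
      qed
    qed (use N in auto)
    then show ?thesis
      using m by (simp add: field_simps)
  qed
  then show ?thesis
    unfolding steiner_ratio_def[of Y] using nontrivial by (intro cInf_greatest) auto
qed

section \<open>Smooth maps and bilinear forms\<close>

text \<open>Derivatives at a point of an open set see only nearby values, so agreement on
  \<open>S\<close> passes on to the derivatives of every order.\<close>

lemma Ck_on_cong:
  assumes "open S" "\<And>x. x \<in> S \<Longrightarrow> f x = g x"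
  shows "Ck_on k f S \<longleftrightarrow> Ck_on k g S"
proof -
  have "Ck_on k g S" if "Ck_on k f S" "\<And>x. x \<in> S \<Longrightarrow> f x = g x" for f g :: "'a \<Rightarrow> 'b"
    using that
  proof (induction k arbitrary: f g)
    case 0
    then show ?case by (simp cong: continuous_on_cong)
  next
    case (Suc k)
    have f: "f differentiable (at x)" if "x \<in> S" for x
      using Suc.prems(1) that by simp
    have eq: "frechet_derivative f (at x) = frechet_derivative g (at x)" if "x \<in> S" for x
      using f[OF that] \<open>open S\<close> that Suc.prems(2) by (rule frechet_derivative_transform_within_open)
    have "g differentiable (at x)" if x: "x \<in> S" for x
    proof -
      obtain D where "(f has_derivative D) (at x)"
        using f[OF x] by (auto simp: differentiable_def)
      then have "(g has_derivative D) (at x)"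
        using \<open>open S\<close> x Suc.prems(2) by (rule has_derivative_transform_within_open)
      then show ?thesis
        by (auto simp: differentiable_def)
    qed
    moreover have "Ck_on k (\<lambda>x. frechet_derivative g (at x) v) S" for v
    proof (rule Suc.IH)
      show "Ck_on k (\<lambda>x. frechet_derivative f (at x) v) S"
        using Suc.prems(1) by simp
    qed (simp add: eq)
    ultimately show ?case by simp
  qed
  then show ?thesis
    using assms(2) by metis
qed

text \<open>For a line the induction closes: the derivative of the composite is a derivative of
  \<open>f\<close> in a constant direction, composed with the same line.\<close>

lemma Ck_on_compose_line:
  fixes a v :: "'a::euclidean_space" and S :: "real set"
  assumes "open S" "\<And>r. r \<in> S \<Longrightarrow> a + r *\<^sub>R v \<in> X" "Ck_on k f X"
  shows "Ck_on k (\<lambda>r. f (a + r *\<^sub>R v)) S"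
  using assms(3)
proof (induction k arbitrary: f)
  case 0
  have "continuous_on S (\<lambda>r. a + r *\<^sub>R v)"
    by (intro continuous_intros)
  then show ?case
    using 0 assms(2) by (auto elim: continuous_on_compose2)
next
  case (Suc k)
  have D: "((\<lambda>r. f (a + r *\<^sub>R v)) has_derivative
      (\<lambda>w. frechet_derivative f (at (a + r *\<^sub>R v)) (w *\<^sub>R v))) (at r)" if "r \<in> S" for r
  proof -
    have line: "((\<lambda>r. a + r *\<^sub>R v) has_derivative (\<lambda>w. w *\<^sub>R v)) (at r)"
      by (auto intro!: derivative_eq_intros)
    have "(f has_derivative frechet_derivative f (at (a + r *\<^sub>R v))) (at (a + r *\<^sub>R v))"
      using Suc.prems assms(2)[OF that] by (simp add: frechet_derivative_works)
    from diff_chain_at[OF line this] show ?thesis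
      by (simp add: o_def)
  qed
  have "Ck_on k (\<lambda>r. frechet_derivative (\<lambda>r. f (a + r *\<^sub>R v)) (at r) w) S" for w
  proof -
    have "Ck_on k (\<lambda>r. frechet_derivative f (at (a + r *\<^sub>R v)) (w *\<^sub>R v)) S"
      by (rule Suc.IH) (use Suc.prems in simp)
    then show ?thesis
      using \<open>open S\<close> by (subst Ck_on_cong) (auto simp flip: frechet_derivative_at[OF D])
  qed
  then show ?case
    using D by (auto simp: differentiable_def)
qed

lemma smooth_on_differentiable: "smooth_on f S \<Longrightarrow> x \<in> S \<Longrightarrow> f differentiable (at x)"
  unfolding smooth_on_def by (metis Ck_on.simps(2))

lemma smooth_on_continuous_on: "smooth_on f S \<Longrightarrow> continuous_on S f"
  unfolding smooth_on_def by (metis Ck_on.simps(1))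

lemma smooth_on_continuous_vector_derivative:
  assumes "smooth_on f S"
  shows "continuous_on S (\<lambda>t. vector_derivative f (at t))"
proof -
  have "Ck_on (Suc 0) f S"
    using assms by (simp only: smooth_on_def)
  then have "continuous_on S (\<lambda>t. frechet_derivative f (at t) 1)"
    by simp
  moreover have "vector_derivative f (at t) = frechet_derivative f (at t) 1" if "t \<in> S" for t
    using smooth_on_differentiable[OF assms that]
    by (metis frechet_derivative_at has_vector_derivative_def scaleR_one vector_derivative_works)
  ultimately show ?thesis
    by (simp cong: continuous_on_cong)
qed

text \<open>The metric is known to be smooth for fixed vectors only. This expansion reduces varying
  vectors to finitely many coefficient functions.\<close>

lemma bilinear_expansion:
  fixes h :: "real ^ 'n \<Rightarrow> real ^ 'm \<Rightarrow> real"
  assumes "bilinear h"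
  shows "h u w = (\<Sum>i\<in>UNIV. \<Sum>j\<in>UNIV. u $ i * w $ j * h (axis i 1) (axis j 1))"
proof -
  have "h u w = h (\<Sum>i\<in>UNIV. (u $ i) *\<^sub>R axis i 1) (\<Sum>j\<in>UNIV. (w $ j) *\<^sub>R axis j 1)"
    using basis_expansion[of u] basis_expansion[of w] by (simp add: scalar_mult_eq_scaleR)
  also have "\<dots> = (\<Sum>(i, j)\<in>UNIV \<times> UNIV. u $ i * w $ j * h (axis i 1) (axis j 1))"
    unfolding bilinear_sum[OF assms] bilinear_lmul[OF assms] bilinear_rmul[OF assms]
    by (simp add: mult_ac)
  finally show ?thesis
    by (simp add: sum.cartesian_product)
qed

text \<open>Gram-Schmidt for the inner product \<open>h\<close>; \<open>L\<close> sends the standard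
  basis to an \<open>h\<close>-orthonormal one.\<close>

lemma ex_orthonormal_coordinates:
  fixes h :: "real ^ 'n \<Rightarrow> real ^ 'n \<Rightarrow> real"
  assumes "bilinear h" and sym: "\<And>u v. h u v = h v u" and pos: "\<And>v. v \<noteq> 0 \<Longrightarrow> 0 < h v v"
  shows "\<exists>L :: real ^ 'n \<Rightarrow> real ^ 'n. linear L \<and> (\<forall>u w. h (L u) (L w) = u \<bullet> w)"
proof -
  note bilin = bilinear_lmul[OF assms(1)] bilinear_rmul[OF assms(1)] bilinear_lsub[OF assms(1)]
  have lin: "linear (\<lambda>u. h u w)" for w
    using assms(1) by (simp add: bilinear_def)
  define orthonormal where
    "orthonormal B \<longleftrightarrow> (\<forall>b\<in>B. \<forall>c\<in>B. h b c = (if b = c then 1 else 0))" for B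
  have "\<exists>B. finite B \<and> card B = k \<and> orthonormal B" if "k \<le> CARD('n)" for k
    using that
  proof (induction k)
    case 0
    then show ?case by (intro exI[of _ "{}"]) (simp add: orthonormal_def)
  next
    case (Suc k)
    then obtain B where B: "finite B" "card B = k" "orthonormal B"
      by auto
    \<comment> \<open>Fewer vectors than the dimension cannot span, so some vector is left to
      orthogonalise.\<close>
    have "dim (span B) < dim (UNIV :: (real ^ 'n) set)"
      using dim_le_card'[OF B(1)] B(2) Suc.prems by (simp add: dim_UNIV)
    then obtain v where v: "v \<notin> span B"
      by (metis UNIV_eq_I less_irrefl)
    define w where "w = v - (\<Sum>b\<in>B. h v b *\<^sub>R b)"
    have "w \<notin> span B"
    proof
      assume "w \<in> span B"
      moreover have "(\<Sum>b\<in>B. h v b *\<^sub>R b) \<in> span B"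
        by (intro span_sum span_scale span_base)
      ultimately have "v \<in> span B"
        unfolding w_def by (metis diff_add_cancel span_add)
      then show False using v by simp
    qed
    then have w0: "w \<noteq> 0"
      using span_zero by auto
    have hw: "h w c = 0" if "c \<in> B" for c
    proof -
      have "h (\<Sum>b\<in>B. h v b *\<^sub>R b) c = (\<Sum>b\<in>B. h v b * h b c)"
        using linear_sum[OF lin[of c], of "\<lambda>b. h v b *\<^sub>R b" B] by (simp add: bilin)
      also have "\<dots> = (\<Sum>b\<in>B. if b = c then h v b else 0)"
        using B(3) that by (intro sum.cong) (auto simp: orthonormal_def)
      finally show ?thesis
        using B(1) that by (simp add: w_def bilin)
    qed
    define e where "e = (1 / sqrt (h w w)) *\<^sub>R w"
    have "h e e = 1"
      using pos[OF w0] by (simp add: e_def bilin real_sqrt_mult_self flip: power2_eq_square)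
    moreover have "h e c = 0" "h c e = 0" if "c \<in> B" for c
      using hw[OF that] sym[of c] by (simp_all add: e_def bilin)
    moreover have "e \<notin> B"
      using calculation by force
    ultimately show ?case
      using B by (intro exI[of _ "insert e B"]) (auto simp: orthonormal_def)
  qed
  then obtain B where B: "finite B" "card B = CARD('n)" "orthonormal B"
    by blast
  then obtain \<beta> :: "'n \<Rightarrow> real ^ 'n" where \<beta>: "bij_betw \<beta> UNIV B"
    using finite_same_card_bij[of "UNIV :: 'n set" B] by auto
  have h\<beta>: "h (\<beta> i) (\<beta> j) = (if i = j then 1 else 0)" for i j
    using B(3) \<beta> by (auto simp: orthonormal_def bij_betw_def inj_on_def)
  define L where "L u = (\<Sum>i\<in>UNIV. u $ i *\<^sub>R \<beta> i)" for u
  have "linear L"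
    unfolding L_def
    by (intro linearI) (auto simp: scaleR_add_left sum.distrib scaleR_sum_right)
  moreover have "h (L u) (L w) = u \<bullet> w" for u w
  proof -
    have "h (L u) (L w) = (\<Sum>i\<in>UNIV. \<Sum>j\<in>UNIV. u $ i * w $ j * h (\<beta> i) (\<beta> j))"
      unfolding L_def
      by (simp add: bilinear_sum[OF assms(1)] bilin sum.cartesian_product mult_ac)
    also have "\<dots> = u \<bullet> w"
      by (simp add: h\<beta> inner_vec_def if_distrib cong: if_cong)
    finally show ?thesis .
  qed
  ultimately show ?thesis by blast
qed

section \<open>Charts adapted to the metric\<close>

context smooth_manifold
begin

lemma chartD:
  assumes "c \<in> A"
  shows "openin T (fst c)" "open (snd c ` fst c)" "inj_on (snd c) (fst c)"
    "continuous_map (subtopology T (fst c)) (top_of_set (snd c ` fst c)) (snd c)"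
    "continuous_map (top_of_set (snd c ` fst c)) T (inv_into (fst c) (snd c))"
    "fst c \<subseteq> topspace T"
proof -
  obtain U \<phi> where c: "c = (U, \<phi>)" by (cases c)
  have *: "openin T U" "open (\<phi> ` U)"
    and h: "homeomorphic_map (subtopology T U) (top_of_set (\<phi> ` U)) \<phi>"
    using chart[OF assms] by (auto simp: chart_of_def c)
  have top: "topspace (subtopology T U) = U"
    using *(1) openin_subset by (auto simp: topspace_subtopology)
  have inj: "inj_on \<phi> U"
    using homeomorphic_imp_injective_map[OF h] top by simp
  have "open_map (subtopology T U) (top_of_set (\<phi> ` U)) \<phi> \<longleftrightarrow>
      continuous_map (top_of_set (\<phi> ` U)) (subtopology T U) (inv_into U \<phi>)"
    by (rule open_eq_continuous_inverse_map) (use top inj in \<open>auto simp: inv_into_into f_inv_into_f\<close>)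
  then have "continuous_map (top_of_set (\<phi> ` U)) (subtopology T U) (inv_into U \<phi>)"
    using homeomorphic_imp_open_map[OF h] by blast
  then show "continuous_map (top_of_set (snd c ` fst c)) T (inv_into (fst c) (snd c))"
    by (simp add: c continuous_map_in_subtopology)
  show "openin T (fst c)" "open (snd c ` fst c)" "inj_on (snd c) (fst c)"
    "continuous_map (subtopology T (fst c)) (top_of_set (snd c ` fst c)) (snd c)"
    using * inj homeomorphic_imp_continuous_map[OF h] by (simp_all add: c)
  then show "fst c \<subseteq> topspace T" by (simp add: openin_subset)
qed

end

text \<open>Coordinates \<open>u\<close> of the point with chart coordinates \<open>z + L u\<close>, in which the metric differs from
  the Euclidean one at most by the factor \<open>K\<close>.\<close>

locale riemannian_normal_chart = riemannian_manifold T A g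
  for T :: "'a topology" and A :: "('a, 'n::finite) chart set"
    and g :: "('a, 'n) chart \<Rightarrow> 'a \<Rightarrow> real ^ 'n \<Rightarrow> real ^ 'n \<Rightarrow> real" +
  fixes c :: "('a, 'n) chart" and z :: "real ^ 'n" and L L' :: "real ^ 'n \<Rightarrow> real ^ 'n"
    and r K :: real
  assumes c: "c \<in> A"
    and L: "linear L" "linear L'" "L' (L u) = u" "L (L' u) = u"
    and K: "0 < K"
    and V: "u \<in> ball 0 r \<Longrightarrow> z + L u \<in> snd c ` fst c"
    and ge: "u \<in> ball 0 r \<Longrightarrow>
      (norm w)\<^sup>2 \<le> K * g c (inv_into (fst c) (snd c) (z + L u)) (L w) (L w)"
    and le: "u \<in> ball 0 r \<Longrightarrow>
      g c (inv_into (fst c) (snd c) (z + L u)) (L w) (L w) \<le> K * (norm w)\<^sup>2"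

context riemannian_manifold
begin

text \<open>\<open>L\<close> turns the metric at \<open>p\<close> into the standard inner product.
  By continuity its finitely many coefficients stay close to those of the identity on a small
  ball.\<close>

lemma ex_normal_chart:
  assumes c: "c \<in> A" "p \<in> fst c" and K: "1 < K"
  shows "\<exists>L L' r. 0 < r \<and> riemannian_normal_chart T A g c (snd c p) L L' r K"
proof -
  let ?V = "snd c ` fst c" and ?\<psi> = "inv_into (fst c) (snd c)"
  have "\<exists>L :: real ^ 'n \<Rightarrow> real ^ 'n. linear L \<and> (\<forall>u w. g c p (L u) (L w) = u \<bullet> w)"
    using metric_bilinear[OF c] metric_sym[OF c] metric_pos[OF c]
    by (rule ex_orthonormal_coordinates)
  then obtain L :: "real ^ 'n \<Rightarrow> real ^ 'n"
    where L: "linear L" and "\<forall>u w. g c p (L u) (L w) = u \<bullet> w"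
    by (elim exE conjE)
  then have gL: "g c p (L u) (L w) = u \<bullet> w" for u w
    by simp
  have "inj L"
  proof (rule linear_injective_0[OF L, THEN iffD2], clarify)
    fix u assume "L u = 0"
    then have "u \<bullet> u = 0"
      using gL[of u u] bilinear_lzero[OF metric_bilinear[OF c]] by simp
    then show "u = 0" by simp
  qed
  then obtain L' where L': "linear L'" "\<And>u. L' (L u) = u" "\<And>u. L (L' u) = u"
    using linear_injective_isomorphism[OF L] by blast
  have Vp: "snd c p \<in> ?V" using c by simp
  define h where "h u w z = g c (?\<psi> (snd c p + L u)) (L w) (L z)" for u w z
  have \<psi>p: "?\<psi> (snd c p) = p"
    using c chartD(3) by (simp add: inv_into_f_f)
  have h0: "h 0 w z = w \<bullet> z" for w z
    using gL by (simp add: h_def linear_0[OF L] \<psi>p)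
  have L_cont: "isCont (\<lambda>u. snd c p + L u) 0"
    by (intro continuous_intros linear_continuous_at) (simp add: L linear_conv_bounded_linear[symmetric])
  have h_cont: "isCont (\<lambda>u. h u w z) 0" for w z
  proof -
    have "continuous_on ?V (\<lambda>x. g c (?\<psi> x) (L w) (L z))"
      using metric_smooth[OF c(1)] by (rule smooth_on_continuous_on)
    then have "isCont (\<lambda>x. g c (?\<psi> x) (L w) (L z)) (snd c p + L 0)"
      using chartD(2)[OF c(1)] c(2) by (simp add: continuous_on_eq_continuous_at linear_0[OF L])
    then show ?thesis
      unfolding h_def by (rule isCont_o2[OF L_cont])
  qed
  define n where "n = real CARD('n)"
  have n: "1 \<le> n" unfolding n_def by (simp add: Suc_leI)
  \<comment> \<open>Summing \<open>n^2\<close> errors below \<open>\<kappa>\<close> gives at most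
    \<open>1 - 1 / K\<close> times the squared norm, so the lower bound comes out with the factor
    \<open>1 / K\<close>.\<close>
  define \<kappa> where "\<kappa> = (1 - 1 / K) / n\<^sup>2"
  have \<kappa>: "0 < \<kappa>" using K n by (simp add: \<kappa>_def)
  \<comment> \<open>With \<open>nhds\<close> instead of \<open>at\<close> the resulting
    neighbourhood statement also covers the centre of the ball.\<close>
  have "((\<lambda>u. h u w z) \<longlongrightarrow> w \<bullet> z) (nhds 0)" for w z
    using h_cont[of w z] tendsto_at_iff_tendsto_nhds[of "\<lambda>u. h u w z" 0]
    by (simp add: isCont_def h0)
  from tendstoD[OF this \<kappa>]
  have "\<forall>\<^sub>F u in nhds 0. \<bar>h u (axis i 1) (axis j 1) - axis i 1 \<bullet> axis j (1::real)\<bar> < \<kappa>" for i j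
    by (simp add: dist_real_def)
  then have "\<forall>\<^sub>F u in nhds 0. \<forall>i j. \<bar>h u (axis i 1) (axis j 1) - axis i 1 \<bullet> axis j (1::real)\<bar> < \<kappa>"
    by (simp add: eventually_all_finite)
  moreover have "\<forall>\<^sub>F u in nhds 0. snd c p + L u \<in> ?V"
  proof (rule topological_tendstoD[OF _ chartD(2)[OF c(1)]])
    show "((\<lambda>u. snd c p + L u) \<longlongrightarrow> snd c p) (nhds 0)"
      using L_cont tendsto_at_iff_tendsto_nhds[of "\<lambda>u. snd c p + L u" 0]
      by (simp add: isCont_def linear_0[OF L])
  qed (rule Vp)
  ultimately have "\<forall>\<^sub>F u in nhds 0. (\<forall>i j. \<bar>h u (axis i 1) (axis j 1) - axis i 1 \<bullet> axis j (1::real)\<bar> < \<kappa>)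
      \<and> snd c p + L u \<in> ?V"
    by (rule eventually_conj)
  then obtain r where r: "0 < r"
    and ball: "\<And>u. dist u 0 < r \<Longrightarrow> (\<forall>i j. \<bar>h u (axis i 1) (axis j 1) - axis i 1 \<bullet> axis j (1::real)\<bar> < \<kappa>)
      \<and> snd c p + L u \<in> ?V"
    unfolding eventually_nhds_metric by blast
  have near: "\<bar>h u (axis i 1) (axis j 1) - axis i 1 \<bullet> axis j (1::real)\<bar> < \<kappa>"
    and V: "snd c p + L u \<in> ?V" if "u \<in> ball 0 r" for u i j
    using ball[of u] that by (simp_all add: dist_commute)
  have close: "\<bar>h u w w - w \<bullet> w\<bar> \<le> (1 - 1 / K) * (norm w)\<^sup>2" if u: "u \<in> ball 0 r" for u w
  proof -
    have "?\<psi> (snd c p + L u) \<in> fst c"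
      using V[OF u] by (rule inv_into_into)
    then have "bilinear (g c (?\<psi> (snd c p + L u)))"
      using c(1) by (intro metric_bilinear)
    then have bil: "bilinear (h u)"
      unfolding h_def bilinear_def
      using linear_compose[OF L, unfolded o_def] by blast
    have bil': "bilinear (\<lambda>w z :: real ^ 'n. w \<bullet> z)"
      using bounded_bilinear_inner by (simp add: bilinear_conv_bounded_bilinear)
    have "\<bar>h u w w - w \<bullet> w\<bar> = \<bar>\<Sum>i\<in>UNIV. \<Sum>j\<in>UNIV. w $ i * w $ j *
        (h u (axis i 1) (axis j 1) - axis i 1 \<bullet> axis j (1::real))\<bar>"
      by (subst bilinear_expansion[OF bil], subst bilinear_expansion[OF bil'])
        (simp add: sum_subtractf right_diff_distrib)
    also have "\<dots> \<le> (\<Sum>i\<in>(UNIV :: 'n set). \<Sum>j\<in>(UNIV :: 'n set). norm w * norm w * \<kappa>)"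
      by (intro order_trans[OF sum_abs] sum_mono)
        (auto simp: abs_mult intro!: mult_mono component_le_norm_cart less_imp_le[OF near[OF u]])
    also have "\<dots> = (1 - 1 / K) * (norm w)\<^sup>2"
      using n by (simp add: \<kappa>_def n_def power2_eq_square)
    finally show ?thesis .
  qed
  have lower: "(norm w)\<^sup>2 \<le> K * h u w w" and upper: "h u w w \<le> K * (norm w)\<^sup>2" if u: "u \<in> ball 0 r" for u w
  proof -
    have ww: "w \<bullet> w = (norm w)\<^sup>2" by (simp add: power2_norm_eq_inner)
    have "(1 / K) * (norm w)\<^sup>2 \<le> h u w w"
      using close[OF u, of w] by (simp add: ww abs_le_iff algebra_simps)
    then show "(norm w)\<^sup>2 \<le> K * h u w w"
      using K by (simp add: field_simps)
    have "h u w w \<le> (2 - 1 / K) * (norm w)\<^sup>2"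
      using close[OF u, of w] by (simp add: ww abs_le_iff algebra_simps)
    \<comment> \<open>This is \<open>(K - 1)^2 \<ge> 0\<close> divided by \<open>K\<close>.\<close>
    also have "2 - 1 / K \<le> K"
      using K sum_squares_bound[of 1 K] by (simp add: field_simps power2_eq_square)
    then have "(2 - 1 / K) * (norm w)\<^sup>2 \<le> K * (norm w)\<^sup>2"
      by (intro mult_right_mono) auto
    finally show "h u w w \<le> K * (norm w)\<^sup>2" .
  qed
  have "riemannian_normal_chart T A g c (snd c p) L L' r K"
  proof
    show "0 < K" using K by simp
  qed (rule c(1) linear_add[OF L] linear_scale[OF L] linear_add[OF L'(1)] linear_scale[OF L'(1)]
      L'(2,3) V lower[unfolded h_def] upper[unfolded h_def], assumption?)+
  then show ?thesis
    using r by blast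
qed

end

section \<open>Speed and length of curves\<close>

text \<open>The extended curve that \<open>smooth_curve_on\<close> asks for, on its own open domain,
  where two-sided derivatives make sense.\<close>

definition smooth_curve_in ::
    "'a topology \<Rightarrow> ('a, 'n::finite) chart set \<Rightarrow> (real \<Rightarrow> 'a) \<Rightarrow> real set \<Rightarrow> bool" where
  "smooth_curve_in T A \<delta> I \<longleftrightarrow> open I \<and> continuous_map (top_of_set I) T \<delta> \<and>
     (\<forall>c\<in>A. smooth_on (snd c \<circ> \<delta>) {r \<in> I. \<delta> r \<in> fst c})"

lemma smooth_curve_on_iff:
  "smooth_curve_on T A \<gamma> s t \<longleftrightarrow>
    (\<exists>\<delta> \<epsilon>. 0 < \<epsilon> \<and> (\<forall>r\<in>{s..t}. \<delta> r = \<gamma> r) \<and> smooth_curve_in T A \<delta> {s - \<epsilon><..<t + \<epsilon>})"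
  unfolding smooth_curve_on_def smooth_curve_in_def by (simp add: case_prod_unfold)

lemma open_smooth_curve_preimage:
  assumes "smooth_curve_in T A \<delta> I" "openin T W"
  shows "open {r \<in> I. \<delta> r \<in> W}"
proof -
  have "openin (top_of_set I) {r \<in> topspace (top_of_set I). \<delta> r \<in> W}"
    using assms unfolding smooth_curve_in_def by (blast intro: openin_continuous_map_preimage)
  then show ?thesis
    using assms(1) by (simp add: smooth_curve_in_def openin_open_eq)
qed

lemma piecewise_smooth_curve_induct [consumes 2, case_names smooth join]:
  assumes "piecewise_smooth_curve T A \<gamma> a b" "a < b"
    and smooth: "\<And>s t. s < t \<Longrightarrow> smooth_curve_on T A \<gamma> s t \<Longrightarrow> P s t"
    and join: "\<And>s t u. s < t \<Longrightarrow> t < u \<Longrightarrow> P s t \<Longrightarrow> P t u \<Longrightarrow> P s u"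
  shows "P a b"
proof -
  obtain k :: nat and \<tau> where \<tau>: "\<tau> 0 = a" "\<tau> k = b"
    and piece: "\<And>i. i < k \<Longrightarrow> \<tau> i < \<tau> (Suc i) \<and> smooth_curve_on T A \<gamma> (\<tau> i) (\<tau> (Suc i))"
    using assms(1) unfolding piecewise_smooth_curve_def by blast
  \<comment> \<open>Starting at \<open>Suc i\<close> avoids the degenerate interval from
    \<open>\<tau> 0\<close> to itself, about which \<open>P\<close> says nothing.\<close>
  have "\<tau> 0 < \<tau> (Suc i) \<and> P (\<tau> 0) (\<tau> (Suc i))" if "i < k" for i
    using that
  proof (induction i)
    case 0
    then show ?case using piece smooth by blast
  next
    case (Suc i)
    then have IH: "\<tau> 0 < \<tau> (Suc i)" "P (\<tau> 0) (\<tau> (Suc i))" by simp_all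
    have "\<tau> (Suc i) < \<tau> (Suc (Suc i))" "P (\<tau> (Suc i)) (\<tau> (Suc (Suc i)))"
      using piece[OF Suc.prems] smooth by blast+
    with IH show ?case using join by (meson less_trans)
  qed
  moreover obtain i where "k = Suc i"
    using \<tau> \<open>a < b\<close> by (cases k) auto
  ultimately show ?thesis
    using \<tau> by blast
qed

context riemannian_manifold
begin

section \<open>Regular times and the speed in an arbitrary chart\<close>

lemma metric_nonneg: "c \<in> A \<Longrightarrow> p \<in> fst c \<Longrightarrow> 0 \<le> g c p v v"
  by (cases "v = 0") (auto simp: bilinear_lzero[OF metric_bilinear] dest: metric_pos less_imp_le)

text \<open>Continuity and differentiability in all charts at one time. It depends only on the curve
  near \<open>r\<close>, so it survives replacing the curve by one that agrees with it
  nearby.\<close>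

definition regular_at :: "(real \<Rightarrow> 'a) \<Rightarrow> real \<Rightarrow> bool" where
  "regular_at \<gamma> r \<longleftrightarrow> (\<forall>W. openin T W \<and> \<gamma> r \<in> W \<longrightarrow> (\<exists>J. open J \<and> r \<in> J \<and> \<gamma> ` J \<subseteq> W)) \<and>
     (\<forall>c\<in>A. \<gamma> r \<in> fst c \<longrightarrow> (snd c \<circ> \<gamma>) differentiable (at r))"

text \<open>\<open>speed\<close> uses an unknown chart picked by \<open>SOME\<close>; the chain rule
  and the transformation law allow any other chart in its place.\<close>

lemma speed_in_chart:
  assumes reg: "regular_at \<gamma> r" and c: "c \<in> A" "\<gamma> r \<in> fst c"
    and v: "((snd c \<circ> \<gamma>) has_vector_derivative v) (at r)"
  shows "speed A g \<gamma> r = sqrt (g c (\<gamma> r) v v)"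
proof -
  define d where "d = (SOME d. d \<in> A \<and> \<gamma> r \<in> fst d)"
  have d: "d \<in> A" "\<gamma> r \<in> fst d"
    using someI[of "\<lambda>d. d \<in> A \<and> \<gamma> r \<in> fst d" c] c unfolding d_def by auto
  let ?D = "frechet_derivative (transition c d) (at (snd c (\<gamma> r)))"
  have "transition c d differentiable (at (snd c (\<gamma> r)))"
    using smooth_transition[OF c(1) d(1)] by (rule smooth_on_differentiable) (use c d in blast)
  then have D: "(transition c d has_derivative ?D) (at ((snd c \<circ> \<gamma>) r))"
    by (simp add: frechet_derivative_works)
  then have lin: "linear ?D"
    by (rule has_derivative_linear)
  have "(transition c d \<circ> (snd c \<circ> \<gamma>) has_derivative ?D \<circ> (\<lambda>h. h *\<^sub>R v)) (at r)"
    using v D unfolding has_vector_derivative_def by (rule diff_chain_at)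
  moreover have "?D \<circ> (\<lambda>h. h *\<^sub>R v) = (\<lambda>h. h *\<^sub>R ?D v)"
    using linear_scale[OF lin] by auto
  ultimately have deriv: "(transition c d \<circ> (snd c \<circ> \<gamma>) has_vector_derivative ?D v) (at r)"
    by (simp add: has_vector_derivative_def)
  \<comment> \<open>Continuity keeps the curve in the domain of \<open>c\<close> near
    \<open>r\<close>, so the two coordinate expressions differ by the transition map on a whole
    neighbourhood.\<close>
  obtain J where J: "open J" "r \<in> J" "\<gamma> ` J \<subseteq> fst c"
    using reg chartD(1)[OF c(1)] c(2) unfolding regular_at_def by blast
  have "((snd d \<circ> \<gamma>) has_vector_derivative ?D v) (at r)"
  proof (rule has_vector_derivative_transform_within_open[OF deriv J(1,2)])
    fix x assume "x \<in> J"
    then have "\<gamma> x \<in> fst c" using J by blast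
    then show "(transition c d \<circ> (snd c \<circ> \<gamma>)) x = (snd d \<circ> \<gamma>) x"
      using chartD(3)[OF c(1)] by (simp add: transition_def inv_into_f_f)
  qed
  then have "vector_derivative (snd d \<circ> \<gamma>) (at r) = ?D v"
    by (rule vector_derivative_at)
  then show ?thesis
    using metric_transform[OF c(1) d(1) c(2) d(2)]
    unfolding speed_def d_def[symmetric] Let_def by simp
qed

text \<open>This covers break points: whatever vector \<open>vector_derivative\<close> returns
  there, the metric is nonnegative on it.\<close>

lemma speed_nonneg:
  assumes "\<gamma> r \<in> topspace T"
  shows "0 \<le> speed A g \<gamma> r"
proof -
  define d where "d = (SOME d. d \<in> A \<and> \<gamma> r \<in> fst d)"
  have "\<exists>d. d \<in> A \<and> \<gamma> r \<in> fst d"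
    using assms cover by auto
  then have "d \<in> A \<and> \<gamma> r \<in> fst d"
    unfolding d_def by (rule someI_ex)
  then show ?thesis
    using metric_nonneg unfolding speed_def d_def[symmetric] Let_def by simp
qed

lemma smooth_curve_in_regular_at:
  assumes "smooth_curve_in T A \<delta> I" "r \<in> I"
  shows "regular_at \<delta> r"
  unfolding regular_at_def
proof (intro conjI allI impI ballI; (elim conjE)?)
  fix W assume "openin T W" "\<delta> r \<in> W"
  then show "\<exists>J. open J \<and> r \<in> J \<and> \<delta> ` J \<subseteq> W"
    using open_smooth_curve_preimage[OF assms(1)] assms(2)
    by (intro exI[of _ "{r \<in> I. \<delta> r \<in> W}"]) auto
next
  fix c assume "c \<in> A" "\<delta> r \<in> fst c"
  then show "(snd c \<circ> \<delta>) differentiable (at r)"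
    using assms unfolding smooth_curve_in_def
    by (intro smooth_on_differentiable[of _ "{r \<in> I. \<delta> r \<in> fst c}"]) auto
qed

lemma speed_smooth_curve_in:
  assumes "smooth_curve_in T A \<delta> I" "r \<in> I" "c \<in> A" "\<delta> r \<in> fst c"
  shows "((snd c \<circ> \<delta>) has_vector_derivative vector_derivative (snd c \<circ> \<delta>) (at r)) (at r)"
    and "speed A g \<delta> r =
      sqrt (g c (\<delta> r) (vector_derivative (snd c \<circ> \<delta>) (at r)) (vector_derivative (snd c \<circ> \<delta>) (at r)))"
proof -
  have reg: "regular_at \<delta> r"
    using assms(1,2) by (rule smooth_curve_in_regular_at)
  then have "(snd c \<circ> \<delta>) differentiable (at r)"
    using assms(3,4) unfolding regular_at_def by blast
  then show *: "((snd c \<circ> \<delta>) has_vector_derivative vector_derivative (snd c \<circ> \<delta>) (at r)) (at r)"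
    by (simp add: vector_derivative_works)
  show "speed A g \<delta> r =
      sqrt (g c (\<delta> r) (vector_derivative (snd c \<circ> \<delta>) (at r)) (vector_derivative (snd c \<circ> \<delta>) (at r)))"
    using reg assms(3,4) * by (rule speed_in_chart)
qed

lemma smooth_curve_in_topspace: "smooth_curve_in T A \<delta> I \<Longrightarrow> r \<in> I \<Longrightarrow> \<delta> r \<in> topspace T"
  by (auto simp: smooth_curve_in_def continuous_map_def)

text \<open>The chart picked by \<open>SOME\<close> may change abruptly with time. Near each time
  the speed is therefore rewritten in one fixed chart first.\<close>

lemma continuous_on_speed:
  assumes \<delta>: "smooth_curve_in T A \<delta> I"
  shows "continuous_on I (speed A g \<delta>)"
proof -
  have "open I" using \<delta> by (simp add: smooth_curve_in_def)
  have "isCont (speed A g \<delta>) r" if r: "r \<in> I" for r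
  proof -
    obtain c where c: "c \<in> A" "\<delta> r \<in> fst c"
      using smooth_curve_in_topspace[OF \<delta> r] cover by auto
    define W where "W = {r \<in> I. \<delta> r \<in> fst c}"
    have W: "open W" "r \<in> W"
      using open_smooth_curve_preimage[OF \<delta> chartD(1)[OF c(1)]] r c by (auto simp: W_def)
    have sm: "smooth_on (snd c \<circ> \<delta>) W"
      using \<delta> c by (simp add: smooth_curve_in_def W_def)
    define v where "v r = vector_derivative (snd c \<circ> \<delta>) (at r)" for r
    have v: "continuous_on W v"
      unfolding v_def using sm by (rule smooth_on_continuous_vector_derivative)
    have "continuous_on W (\<lambda>r. g c (\<delta> r) a b)" for a b
    proof -
      have "continuous_on W (\<lambda>r. g c (inv_into (fst c) (snd c) ((snd c \<circ> \<delta>) r)) a b)"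
      proof (rule continuous_on_compose2[of "snd c ` fst c" _ W "snd c \<circ> \<delta>"])
        show "continuous_on (snd c ` fst c) (\<lambda>x. g c (inv_into (fst c) (snd c) x) a b)"
          using metric_smooth[OF c(1)] by (rule smooth_on_continuous_on)
        show "continuous_on W (snd c \<circ> \<delta>)"
          using sm by (rule smooth_on_continuous_on)
      qed (auto simp: W_def)
      then show ?thesis
        by (rule continuous_on_eq) (use chartD(3)[OF c(1)] in \<open>auto simp: W_def\<close>)
    qed
    then have "continuous_on W (\<lambda>r. sqrt (\<Sum>i\<in>UNIV. \<Sum>j\<in>UNIV.
        v r $ i * v r $ j * g c (\<delta> r) (axis i 1) (axis j 1)))"
      by (intro continuous_intros v)
    then have "continuous_on W (speed A g \<delta>)"
    proof (rule continuous_on_eq)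
      fix s assume "s \<in> W"
      then have s: "s \<in> I" "\<delta> s \<in> fst c" by (auto simp: W_def)
      show "sqrt (\<Sum>i\<in>UNIV. \<Sum>j\<in>UNIV. v s $ i * v s $ j * g c (\<delta> s) (axis i 1) (axis j 1))
          = speed A g \<delta> s"
        using speed_smooth_curve_in(2)[OF \<delta> s(1) c(1) s(2)]
          bilinear_expansion[OF metric_bilinear[OF c(1) s(2)], of "v s" "v s"]
        by (simp add: v_def)
    qed
    then show ?thesis
      using W by (simp add: continuous_on_eq_continuous_at)
  qed
  then show ?thesis
    by (simp add: continuous_at_imp_continuous_on)
qed

text \<open>Continuity of the curve is expressed by closed preimages, which makes it easy to join
  adjacent pieces.\<close>

definition admissible :: "(real \<Rightarrow> 'a) \<Rightarrow> real \<Rightarrow> real \<Rightarrow> bool" where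
  "admissible \<gamma> s t \<longleftrightarrow> \<gamma> ` {s..t} \<subseteq> topspace T \<and>
     (\<forall>C. closedin T C \<longrightarrow> closed {r \<in> {s..t}. \<gamma> r \<in> C}) \<and>
     speed A g \<gamma> integrable_on {s..t} \<and>
     (\<exists>S. finite S \<and> (\<forall>r\<in>{s<..<t} - S. regular_at \<gamma> r))"

lemma admissibleD:
  assumes "admissible \<gamma> s t"
  shows "r \<in> {s..t} \<Longrightarrow> \<gamma> r \<in> topspace T"
    and "closedin T C \<Longrightarrow> closed {r \<in> {s..t}. \<gamma> r \<in> C}"
    and "speed A g \<gamma> integrable_on {s..t}"
    and "\<exists>S. finite S \<and> (\<forall>r\<in>{s<..<t} - S. regular_at \<gamma> r)"
  using assms by (simp_all only: admissible_def image_subset_iff)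

text \<open>\<open>\<gamma>\<close> agrees with its extension \<open>\<delta>\<close> on
  \<open>{s..t}\<close> only, so two-sided notions transfer to the interior; the two end points do
  not affect integrability.\<close>

lemma smooth_curve_on_admissible:
  assumes "s < t" "smooth_curve_on T A \<gamma> s t"
  shows "admissible \<gamma> s t"
proof -
  obtain \<delta> \<epsilon> where "0 < \<epsilon>" and eq: "\<And>r. r \<in> {s..t} \<Longrightarrow> \<delta> r = \<gamma> r"
    and \<delta>: "smooth_curve_in T A \<delta> {s - \<epsilon><..<t + \<epsilon>}"
    using assms(2) unfolding smooth_curve_on_iff by blast
  let ?I = "{s - \<epsilon><..<t + \<epsilon>}"
  have sub: "{s..t} \<subseteq> ?I"
    using \<open>0 < \<epsilon>\<close> by auto
  have "\<gamma> r \<in> topspace T" if "r \<in> {s..t}" for r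
    using smooth_curve_in_topspace[OF \<delta>, of r] sub eq[OF that] that by auto
  moreover have "closed {r \<in> {s..t}. \<gamma> r \<in> C}" if "closedin T C" for C
  proof -
    have "continuous_map (top_of_set {s..t}) T \<delta>"
      using \<delta> sub unfolding smooth_curve_in_def by (blast intro: continuous_map_from_subtopology_mono)
    from closedin_continuous_map_preimage[OF this that]
    have "closedin (top_of_set {s..t}) {r \<in> {s..t}. \<delta> r \<in> C}" by simp
    then have "closed {r \<in> {s..t}. \<delta> r \<in> C}"
      by (simp add: closedin_closed_eq)
    moreover have "{r \<in> {s..t}. \<delta> r \<in> C} = {r \<in> {s..t}. \<gamma> r \<in> C}"
      using eq by auto
    ultimately show ?thesis by simp
  qed
  moreover have reg: "regular_at \<gamma> r" if r: "r \<in> {s<..<t}" for r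
    unfolding regular_at_def
  proof (intro conjI allI impI ballI; (elim conjE)?)
    have \<delta>r: "regular_at \<delta> r"
      using smooth_curve_in_regular_at[OF \<delta>, of r] r \<open>0 < \<epsilon>\<close> by simp
    have \<gamma>r: "\<delta> r = \<gamma> r"
      using eq r by simp
    show "\<exists>J. open J \<and> r \<in> J \<and> \<gamma> ` J \<subseteq> W" if W: "openin T W" "\<gamma> r \<in> W" for W
    proof -
      obtain J where "open J" "r \<in> J" "\<delta> ` J \<subseteq> W"
        using \<delta>r \<gamma>r W unfolding regular_at_def by metis
      then have "open (J \<inter> {s<..<t})" "r \<in> J \<inter> {s<..<t}" "\<gamma> ` (J \<inter> {s<..<t}) \<subseteq> W"
        using r eq by force+
      then show ?thesis by blast
    qed
    show "(snd c \<circ> \<gamma>) differentiable (at r)" if c: "c \<in> A" "\<gamma> r \<in> fst c" for c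
    proof -
      obtain D where "((snd c \<circ> \<delta>) has_derivative D) (at r)"
        using \<delta>r \<gamma>r c unfolding regular_at_def differentiable_def by auto
      then have "((snd c \<circ> \<gamma>) has_derivative D) (at r)"
        by (rule has_derivative_transform_within_open[of _ _ _ _ "{s<..<t}"]) (use r eq in auto)
      then show ?thesis
        by (auto simp: differentiable_def)
    qed
  qed
  moreover have "speed A g \<gamma> integrable_on {s..t}"
  proof -
    have "speed A g \<gamma> r = speed A g \<delta> r" if r: "r \<in> {s<..<t}" for r
    proof -
      have rI: "r \<in> ?I"
        using r \<open>0 < \<epsilon>\<close> by simp
      have \<gamma>r: "\<delta> r = \<gamma> r"
        using eq r by simp
      obtain c where c: "c \<in> A" "\<delta> r \<in> fst c"
        using smooth_curve_in_topspace[OF \<delta> rI] cover by auto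
      let ?v = "vector_derivative (snd c \<circ> \<delta>) (at r)"
      have "((snd c \<circ> \<gamma>) has_vector_derivative ?v) (at r)"
        by (rule has_vector_derivative_transform_within_open
            [OF speed_smooth_curve_in(1)[OF \<delta> rI c], of "{s<..<t}"]) (use r eq in auto)
      from speed_in_chart[OF reg[OF r] c(1) _ this] show ?thesis
        using speed_smooth_curve_in(2)[OF \<delta> rI c] c(2) \<gamma>r by simp
    qed
    moreover have "speed A g \<delta> integrable_on cbox s t"
      using continuous_on_speed[OF \<delta>] sub
      by (intro integrable_continuous) (auto intro: continuous_on_subset)
    ultimately have "speed A g \<gamma> integrable_on cbox s t"
      using integrable_spike_interior[of s t "speed A g \<gamma>" "speed A g \<delta>"] by simp
    then show ?thesis by simp
  qed
  ultimately show ?thesis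
    unfolding admissible_def by (intro conjI exI[of _ "{}"]) (simp_all add: image_subset_iff)
qed

lemma piecewise_smooth_curve_admissible:
  assumes "piecewise_smooth_curve T A \<gamma> a b" "a < b"
  shows "admissible \<gamma> a b"
  using assms
proof (induction rule: piecewise_smooth_curve_induct)
  case (smooth s t)
  then show ?case by (rule smooth_curve_on_admissible)
next
  case (join s t u)
  have un: "{s..u} = {s..t} \<union> {t..u}"
    using join.hyps by auto
  have cl: "closed {r \<in> {s..u}. \<gamma> r \<in> C}" if "closedin T C" for C
  proof -
    have "{r \<in> {s..u}. \<gamma> r \<in> C} = {r \<in> {s..t}. \<gamma> r \<in> C} \<union> {r \<in> {t..u}. \<gamma> r \<in> C}"
      unfolding un by blast
    moreover have "closed {r \<in> {s..t}. \<gamma> r \<in> C}" "closed {r \<in> {t..u}. \<gamma> r \<in> C}"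
      using join.IH that by (simp_all only: admissibleD)
    ultimately show ?thesis
      by (simp only: closed_Un)
  qed
  \<comment> \<open>The joint \<open>t\<close> may be a corner and is added to the exceptional times
    of both pieces.\<close>
  from join.IH[THEN admissibleD(4)] obtain S1 S2 where "finite S1" "\<forall>r\<in>{s<..<t} - S1. regular_at \<gamma> r"
    and "finite S2" "\<forall>r\<in>{t<..<u} - S2. regular_at \<gamma> r"
    by (elim exE conjE)
  moreover have "{s<..<u} - insert t (S1 \<union> S2) \<subseteq> ({s<..<t} - S1) \<union> ({t<..<u} - S2)"
    by auto
  ultimately have "finite (insert t (S1 \<union> S2)) \<and>
      (\<forall>r\<in>{s<..<u} - insert t (S1 \<union> S2). regular_at \<gamma> r)"
    by blast
  then have reg: "\<exists>S. finite S \<and> (\<forall>r\<in>{s<..<u} - S. regular_at \<gamma> r)" ..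
  have int: "speed A g \<gamma> integrable_on {s..u}"
    using join.hyps[THEN less_imp_le] join.IH[THEN admissibleD(3)]
    by (rule Henstock_Kurzweil_Integration.integrable_combine)
  have top: "\<gamma> ` {s..u} \<subseteq> topspace T"
    using join.IH[THEN admissibleD(1)] unfolding un by blast
  show ?case
    unfolding admissible_def by (intro conjI allI impI top cl int reg)
qed

lemma curve_length_nonneg:
  assumes "admissible \<gamma> a b"
  shows "0 \<le> curve_length A g \<gamma> a b"
  unfolding curve_length_def
proof (rule integral_nonneg)
  show "speed A g \<gamma> integrable_on {a..b}"
    using assms by (rule admissibleD)
  show "0 \<le> speed A g \<gamma> r" if "r \<in> {a..b}" for r
    using admissibleD(1)[OF assms that] by (rule speed_nonneg)
qed

end

section \<open>Joining points by curves\<close>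

context riemannian_manifold
begin

text \<open>In any other chart \<open>d\<close> the line becomes the transition map composed with a
  line, which \<open>Ck_on_compose_line\<close> handles.\<close>

lemma smooth_curve_in_line:
  assumes c: "c \<in> A" and "open I" and V: "\<And>r. r \<in> I \<Longrightarrow> z + r *\<^sub>R v \<in> snd c ` fst c"
  shows "smooth_curve_in T A (\<lambda>r. inv_into (fst c) (snd c) (z + r *\<^sub>R v)) I" (is "smooth_curve_in T A ?\<delta> I")
proof -
  have "continuous_on I (\<lambda>r. z + r *\<^sub>R v)"
    by (intro continuous_intros)
  then have "continuous_map (top_of_set I) (top_of_set (snd c ` fst c)) (\<lambda>r. z + r *\<^sub>R v)"
    using V by (auto simp: continuous_map_in_subtopology)
  from continuous_map_compose[OF this chartD(5)[OF c]]
  have cont: "continuous_map (top_of_set I) T ?\<delta>"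
    by (simp add: o_def)
  have "smooth_on (snd d \<circ> ?\<delta>) {r \<in> I. ?\<delta> r \<in> fst d}" if d: "d \<in> A" for d
  proof -
    have "openin (top_of_set I) {r \<in> I. ?\<delta> r \<in> fst d}"
      using openin_continuous_map_preimage[OF cont chartD(1)[OF d]] by simp
    then have op: "open {r \<in> I. ?\<delta> r \<in> fst d}"
      using \<open>open I\<close> by (simp add: openin_open_eq)
    have in_overlap: "z + r *\<^sub>R v \<in> snd c ` (fst c \<inter> fst d)" if "r \<in> {r \<in> I. ?\<delta> r \<in> fst d}" for r
      using that V[of r] inv_into_into[of "z + r *\<^sub>R v" "snd c" "fst c"]
        f_inv_into_f[of "z + r *\<^sub>R v" "snd c" "fst c"]
      by (intro rev_image_eqI[of "?\<delta> r"]) auto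
    have "Ck_on k (\<lambda>r. transition c d (z + r *\<^sub>R v)) {r \<in> I. ?\<delta> r \<in> fst d}" for k
      using op in_overlap
    proof (rule Ck_on_compose_line)
      show "Ck_on k (transition c d) (snd c ` (fst c \<inter> fst d))"
        using smooth_transition[OF c d] by (simp add: smooth_on_def)
    qed
    then show ?thesis
      by (simp add: smooth_on_def transition_def o_def)
  qed
  then show ?thesis
    using \<open>open I\<close> cont by (simp add: smooth_curve_in_def)
qed

text \<open>The range \<open>-1 < r < 2\<close> leaves room beyond both ends of the segment for the
  smooth extension. It also explains the 5: \<open>\<rho> / 5\<close> for \<open>x\<close> plus
  twice the bound \<open>2 * (\<rho> / 5)\<close> for \<open>y - x\<close> makes
  \<open>\<rho>\<close>.\<close>

lemma segment_in_ball:
  fixes x y :: "'b::real_normed_vector"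
  assumes "x \<in> ball z (\<rho> / 5)" "y \<in> ball z (\<rho> / 5)" "-1 < r" "r < 2"
  shows "x + r *\<^sub>R (y - x) \<in> ball z \<rho>"
proof -
  have x: "norm (x - z) < \<rho> / 5" and y: "norm (y - z) < \<rho> / 5"
    using assms(1,2) by (simp_all add: dist_norm norm_minus_commute)
  have "norm (y - x) \<le> norm (y - z) + norm (x - z)"
    using norm_triangle_ineq4[of "y - z" "x - z"] by simp
  then have xy: "norm (y - x) \<le> 2 * (\<rho> / 5)"
    using x y by simp
  have "\<bar>r\<bar> * norm (y - x) \<le> 2 * (2 * (\<rho> / 5))"
    using assms(3,4) xy by (intro mult_mono) auto
  moreover have "norm (x + r *\<^sub>R (y - x) - z) \<le> norm (x - z) + \<bar>r\<bar> * norm (y - x)"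
    using norm_triangle_ineq[of "x - z" "r *\<^sub>R (y - x)"] by (simp add: add_diff_eq diff_add_eq)
  ultimately have "norm (x + r *\<^sub>R (y - x) - z) < \<rho>"
    using x by linarith
  then show ?thesis
    by (simp add: dist_norm norm_minus_commute)
qed

text \<open>The starting time \<open>b\<close> is free, so that the segment can be appended to a
  curve that ends at time \<open>b\<close>.\<close>

lemma segment_smooth_curve:
  assumes c: "c \<in> A" and V: "ball z \<rho> \<subseteq> snd c ` fst c"
    and xy: "x \<in> ball z (\<rho> / 5)" "y \<in> ball z (\<rho> / 5)"
  shows "smooth_curve_on T A (\<lambda>r. inv_into (fst c) (snd c) (x + (r - b) *\<^sub>R (y - x))) b (b + 1)"
proof -
  let ?\<delta> = "\<lambda>r. inv_into (fst c) (snd c) ((x - b *\<^sub>R (y - x)) + r *\<^sub>R (y - x))"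
  have line: "(x - b *\<^sub>R (y - x)) + r *\<^sub>R (y - x) = x + (r - b) *\<^sub>R (y - x)" for r
    by (simp add: algebra_simps)
  have "smooth_curve_in T A ?\<delta> {b - 1<..<b + 1 + 1}"
  proof (rule smooth_curve_in_line[OF c])
    show "(x - b *\<^sub>R (y - x)) + r *\<^sub>R (y - x) \<in> snd c ` fst c" if "r \<in> {b - 1<..<b + 1 + 1}" for r
      using segment_in_ball[OF xy, of "r - b"] that V unfolding line by auto
  qed simp
  then show ?thesis
    unfolding smooth_curve_on_iff line by (intro exI conjI) (auto intro: zero_less_one)
qed

text \<open>Says exactly that the set whose \<open>Inf\<close> is \<open>riemannian_dist\<close> is
  nonempty.\<close>

definition joinable :: "'a \<Rightarrow> 'a \<Rightarrow> bool" where
  "joinable x y \<longleftrightarrow> (\<exists>\<gamma> a b. a < b \<and> \<gamma> a = x \<and> \<gamma> b = y \<and> piecewise_smooth_curve T A \<gamma> a b)"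

lemma smooth_curve_on_cong:
  assumes "\<And>r. r \<in> {s..t} \<Longrightarrow> \<gamma> r = \<gamma>' r"
  shows "smooth_curve_on T A \<gamma> s t \<longleftrightarrow> smooth_curve_on T A \<gamma>' s t"
  using assms by (simp add: smooth_curve_on_def)

lemma joinable_step:
  assumes "joinable x y" "\<And>b. smooth_curve_on T A (\<lambda>r. \<delta> (r - b)) b (b + 1)" "\<delta> 0 = y" "\<delta> 1 = z"
  shows "joinable x z"
proof -
  obtain \<gamma> a b where ab: "a < b" and \<gamma>: "\<gamma> a = x" "\<gamma> b = y" "piecewise_smooth_curve T A \<gamma> a b"
    using assms(1) unfolding joinable_def by blast
  obtain k :: nat and \<tau> where \<tau>: "\<tau> 0 = a" "\<tau> k = b"
    and piece: "\<And>i. i < k \<Longrightarrow> \<tau> i < \<tau> (Suc i) \<and> smooth_curve_on T A \<gamma> (\<tau> i) (\<tau> (Suc i))"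
    using \<gamma>(3) unfolding piecewise_smooth_curve_def by blast
  define \<gamma>' where "\<gamma>' r = (if r \<le> b then \<gamma> r else \<delta> (r - b))" for r
  define \<tau>' where "\<tau>' = \<tau>(Suc k := b + 1)"
  \<comment> \<open>All old pieces end by time \<open>b\<close>, up to which
    \<open>\<gamma>'\<close> equals \<open>\<gamma>\<close>.\<close>
  have "\<tau> (Suc i) \<le> b" if "i < k" for i
  proof -
    have "\<tau> (Suc i) \<le> \<tau> k"
      using \<open>i < k\<close> by (induction rule: strict_inc_induct) (use piece in force)+
    then show ?thesis using \<tau> by simp
  qed
  then have old: "smooth_curve_on T A \<gamma>' (\<tau> i) (\<tau> (Suc i))" if "i < k" for i
    using piece[OF that] that by (subst smooth_curve_on_cong[of _ _ \<gamma>' \<gamma>]) (force simp: \<gamma>'_def)+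
  have new: "smooth_curve_on T A \<gamma>' b (b + 1)"
    using assms(2)[of b] assms(3) \<gamma>(2)
    by (subst smooth_curve_on_cong[of _ _ \<gamma>' "\<lambda>r. \<delta> (r - b)"]) (auto simp: \<gamma>'_def)
  have "piecewise_smooth_curve T A \<gamma>' a (b + 1)"
    unfolding piecewise_smooth_curve_def
  proof (intro exI conjI allI impI)
    show "\<tau>' 0 = a" "\<tau>' (Suc k) = b + 1"
      using \<tau> by (auto simp: \<tau>'_def)
    fix i assume "i < Suc k"
    then show "\<tau>' i < \<tau>' (Suc i)" "smooth_curve_on T A \<gamma>' (\<tau>' i) (\<tau>' (Suc i))"
      using piece[of i] old[of i] new \<tau> by (cases "i = k"; simp add: \<tau>'_def)+
  qed
  moreover have "\<gamma>' a = x" "\<gamma>' (b + 1) = z"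
    using ab \<gamma> assms(4) by (auto simp: \<gamma>'_def)
  ultimately show ?thesis
    unfolding joinable_def using ab by (intro exI[of _ \<gamma>'] exI[of _ a] exI[of _ "b + 1"]) auto
qed

lemma openin_inverse_chart_image:
  assumes c: "c \<in> A" and W: "open W" "W \<subseteq> snd c ` fst c"
  shows "openin T (inv_into (fst c) (snd c) ` W)"
proof -
  have "openin (top_of_set (snd c ` fst c)) W"
    using W by (simp add: open_subset)
  from openin_continuous_map_preimage[OF chartD(4)[OF c] this]
  have "openin T {q \<in> topspace (subtopology T (fst c)). snd c q \<in> W}"
    using chartD(1)[OF c] by (rule openin_trans_full)
  also have "{q \<in> topspace (subtopology T (fst c)). snd c q \<in> W} = inv_into (fst c) (snd c) ` W"
  proof (intro equalityI subsetI)
    fix q assume "q \<in> {q \<in> topspace (subtopology T (fst c)). snd c q \<in> W}"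
    then have "snd c q \<in> W" "inv_into (fst c) (snd c) (snd c q) = q"
      using chartD(3)[OF c] by auto
    then show "q \<in> inv_into (fst c) (snd c) ` W" by (metis imageI)
  next
    fix q assume "q \<in> inv_into (fst c) (snd c) ` W"
    then obtain w where w: "w \<in> W" "q = inv_into (fst c) (snd c) w" by blast
    then have "q \<in> fst c" "snd c q = w"
      using W(2) by (auto simp: inv_into_into f_inv_into_f)
    then show "q \<in> {q \<in> topspace (subtopology T (fst c)). snd c q \<in> W}"
      using w(1) chartD(6)[OF c] by auto
  qed
  finally show ?thesis .
qed

text \<open>A set closed in the chart image may fail to be closed in \<open>T\<close>; a compact one
  stays compact, and \<open>T\<close> is Hausdorff.\<close>

lemma closedin_inverse_chart_image:
  assumes c: "c \<in> A" and W: "compact W" "W \<subseteq> snd c ` fst c"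
  shows "closedin T (inv_into (fst c) (snd c) ` W)"
proof -
  have "compactin (top_of_set (snd c ` fst c)) W"
    using W by (simp add: compactin_subtopology)
  then have "compactin T (inv_into (fst c) (snd c) ` W)"
    using chartD(5)[OF c] by (rule image_compactin)
  then show ?thesis
    using Hausdorff by (intro compactin_imp_closedin)
qed

lemma smooth_curve_joinable:
  assumes "smooth_curve_on T A \<delta> 0 1"
  shows "joinable (\<delta> 0) (\<delta> 1)"
  unfolding joinable_def piecewise_smooth_curve_def using assms
  by (intro exI[of _ \<delta>] exI[of _ "0 :: real"] exI[of _ "1 :: real"] conjI
      exI[of _ "1 :: nat"] exI[of _ real]) auto

lemma ball_in_chart:
  assumes "c \<in> A" "x \<in> fst c"
  obtains \<rho> where "0 < \<rho>" "ball (snd c x) \<rho> \<subseteq> snd c ` fst c"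
  using chartD(2)[OF assms(1)] assms(2) by (metis imageI open_contains_ball)

text \<open>Appending one segment within a coordinate ball suffices. Since \<open>z\<close>,
  \<open>y\<close> and \<open>w\<close> are arbitrary, the same \<open>W\<close> shows that the set
  of points joinable from \<open>z\<close> is open and that its complement is.\<close>

lemma locally_joinable:
  assumes "x \<in> topspace T"
  shows "joinable x x"
    and "\<exists>W. openin T W \<and> x \<in> W \<and>
      (\<forall>z. \<forall>y\<in>W. \<forall>w\<in>W. joinable z y \<longrightarrow> joinable z w)"
proof -
  obtain c where c: "c \<in> A" "x \<in> fst c"
    using assms cover by auto
  let ?\<psi> = "inv_into (fst c) (snd c)"
  obtain \<rho> where \<rho>: "0 < \<rho>" and V: "ball (snd c x) \<rho> \<subseteq> snd c ` fst c"
    using ball_in_chart[OF c] .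
  let ?B = "ball (snd c x) (\<rho> / 5)"
  have xB: "snd c x \<in> ?B" and B: "?B \<subseteq> snd c ` fst c"
    using \<rho> V by (auto simp: subset_iff)
  have \<psi>x: "?\<psi> (snd c x) = x"
    using c chartD(3) by (simp add: inv_into_f_f)
  have "smooth_curve_on T A (\<lambda>r. ?\<psi> (snd c x + r *\<^sub>R (snd c x - snd c x))) 0 1"
    using segment_smooth_curve[OF c(1) V xB xB, of 0] by simp
  from smooth_curve_joinable[OF this] show "joinable x x"
    by (simp add: \<psi>x)
  have "joinable z w" if join: "joinable z y" and yw: "y \<in> ?\<psi> ` ?B" "w \<in> ?\<psi> ` ?B" for z y w
  proof -
    obtain y' w' where "y' \<in> ?B" "w' \<in> ?B" and eq: "y = ?\<psi> y'" "w = ?\<psi> w'"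
      using yw by blast
    from segment_smooth_curve[OF c(1) V this(1,2)]
    show ?thesis
      by (rule joinable_step[OF join, of "\<lambda>r. ?\<psi> (y' + r *\<^sub>R (w' - y'))"]) (simp_all add: eq)
  qed
  moreover have "openin T (?\<psi> ` ?B)"
    using B by (intro openin_inverse_chart_image c) auto
  moreover have "x \<in> ?\<psi> ` ?B"
    using xB \<psi>x by (metis imageI)
  ultimately show "\<exists>W. openin T W \<and> x \<in> W \<and>
      (\<forall>z. \<forall>y\<in>W. \<forall>w\<in>W. joinable z y \<longrightarrow> joinable z w)"
    by blast
qed

lemma connected_joinable:
  assumes "connected_space T" and x: "x \<in> topspace T" and y: "y \<in> topspace T"
  shows "joinable x y"
proof -
  let ?S = "{y \<in> topspace T. joinable x y}"
  have "\<exists>W. openin T W \<and> y \<in> W \<and> W \<subseteq> ?S" if "y \<in> ?S" for y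
  proof -
    have "y \<in> topspace T" using that by simp
    from locally_joinable(2)[OF this] obtain W where W: "openin T W" "y \<in> W"
      and join: "\<forall>z. \<forall>y\<in>W. \<forall>w\<in>W. joinable z y \<longrightarrow> joinable z w"
      by (elim exE conjE)
    have "W \<subseteq> ?S"
      using W join that openin_subset[OF W(1)] by blast
    then show ?thesis using W by blast
  qed
  then have "openin T ?S"
    by (subst openin_subopen) blast
  \<comment> \<open>A point of \<open>W\<close> joinable from \<open>x\<close> would make
    \<open>y\<close> joinable from \<open>x\<close> as well.\<close>
  moreover have "\<exists>W. openin T W \<and> y \<in> W \<and> W \<subseteq> topspace T - ?S" if y: "y \<in> topspace T - ?S" for y
  proof -
    have "y \<in> topspace T" using y by simp
    from locally_joinable(2)[OF this] obtain W where W: "openin T W" "y \<in> W"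
      and join: "\<forall>z. \<forall>y\<in>W. \<forall>w\<in>W. joinable z y \<longrightarrow> joinable z w"
      by (elim exE conjE)
    have "W \<subseteq> topspace T - ?S"
      using W join y openin_subset[OF W(1)] by blast
    then show ?thesis using W by blast
  qed
  then have "openin T (topspace T - ?S)"
    by (subst openin_subopen) blast
  ultimately have "openin T ?S \<and> closedin T ?S"
    by (auto simp: closedin_def)
  then have "?S = {} \<or> ?S = topspace T"
    using assms(1) unfolding connected_space_clopen_in by blast
  moreover have "x \<in> ?S"
    using locally_joinable(1)[OF x] x by blast
  ultimately show ?thesis
    using y by blast
qed

section \<open>The distance as an infimum: upper and lower bounds\<close>

lemma riemannian_dist_le:
  assumes "a < b" "\<gamma> a = x" "\<gamma> b = y" "piecewise_smooth_curve T A \<gamma> a b"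
  shows "riemannian_dist T A g x y \<le> curve_length A g \<gamma> a b"
  unfolding riemannian_dist_def
proof (rule cInf_lower)
  show "bdd_below {curve_length A g \<gamma> a b |\<gamma> a b.
      a < b \<and> \<gamma> a = x \<and> \<gamma> b = y \<and> piecewise_smooth_curve T A \<gamma> a b}"
    by (rule bdd_belowI[of _ 0])
      (use curve_length_nonneg piecewise_smooth_curve_admissible in blast)
qed (use assms in blast)

text \<open>Joinability excludes the value \<open>Inf {}\<close>. Passing to admissible curves, a
  wider class, keeps just what the length estimate uses.\<close>

lemma riemannian_dist_ge:
  assumes "joinable x y"
    and "\<And>\<gamma> a b. a < b \<Longrightarrow> \<gamma> a = x \<Longrightarrow> \<gamma> b = y \<Longrightarrow> admissible \<gamma> a b \<Longrightarrow> d \<le> curve_length A g \<gamma> a b"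
  shows "d \<le> riemannian_dist T A g x y"
  unfolding riemannian_dist_def
proof (rule cInf_greatest)
  show "{curve_length A g \<gamma> a b |\<gamma> a b.
      a < b \<and> \<gamma> a = x \<and> \<gamma> b = y \<and> piecewise_smooth_curve T A \<gamma> a b} \<noteq> {}"
    using assms(1) unfolding joinable_def by blast
qed (use assms(2) piecewise_smooth_curve_admissible in blast)

lemma riemannian_dist_nonneg: "joinable x y \<Longrightarrow> 0 \<le> riemannian_dist T A g x y"
  by (rule riemannian_dist_ge) (auto intro: curve_length_nonneg)

end

section \<open>Comparison with the Euclidean distance\<close>

context riemannian_normal_chart
begin

section \<open>Normal coordinates and their inverse\<close>

definition \<sigma> :: "real ^ 'n \<Rightarrow> 'a" where
  "\<sigma> u = inv_into (fst c) (snd c) (z + L u)"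

definition \<phi> :: "'a \<Rightarrow> real ^ 'n" where
  "\<phi> q = L' (snd c q - z)"

lemma \<sigma>_in: "u \<in> ball 0 r \<Longrightarrow> \<sigma> u \<in> fst c"
  unfolding \<sigma>_def using V by (intro inv_into_into)

lemma \<phi>_\<sigma>: "u \<in> ball 0 r \<Longrightarrow> \<phi> (\<sigma> u) = u"
  unfolding \<sigma>_def \<phi>_def using f_inv_into_f[OF V] by (simp add: L)

lemma continuous_on_affine: "continuous_on S (\<lambda>u. z + L u)"
  using L(1) by (intro continuous_intros linear_continuous_on) (simp add: linear_linear)

lemma openin_\<sigma>:
  assumes "open S" "S \<subseteq> ball 0 r"
  shows "openin T (\<sigma> ` S)"
proof -
  \<comment> \<open>The affine image of \<open>S\<close> is open because it is the preimage of
    \<open>S\<close> under the inverse affine map.\<close>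
  have "continuous_on UNIV (\<lambda>x. L' (x - z))"
    by (intro linear_continuous_on_compose[OF _ L(2)] continuous_intros)
  then have "open ((\<lambda>x. L' (x - z)) -` S)"
    using assms(1) by (rule open_vimage[rotated])
  also have "(\<lambda>x. L' (x - z)) -` S = (\<lambda>u. z + L u) ` S"
  proof (intro equalityI subsetI)
    fix x assume "x \<in> (\<lambda>x. L' (x - z)) -` S"
    then show "x \<in> (\<lambda>u. z + L u) ` S"
      by (intro rev_image_eqI[of "L' (x - z)"]) (simp_all add: L)
  qed (auto simp: L)
  finally have "openin T (inv_into (fst c) (snd c) ` (\<lambda>u. z + L u) ` S)"
    using V assms(2) by (intro openin_inverse_chart_image c) auto
  then show ?thesis
    by (simp add: image_image \<sigma>_def)
qed

lemma closedin_\<sigma>: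
  assumes "compact S" "S \<subseteq> ball 0 r"
  shows "closedin T (\<sigma> ` S)"
proof -
  have "compact ((\<lambda>u. z + L u) ` S)"
    using continuous_on_affine assms(1) by (rule compact_continuous_image)
  then have "closedin T (inv_into (fst c) (snd c) ` (\<lambda>u. z + L u) ` S)"
    using V assms(2) by (intro closedin_inverse_chart_image c) auto
  then show ?thesis
    by (simp add: image_image \<sigma>_def)
qed

text \<open>In normal coordinates a chart velocity \<open>w\<close> reads \<open>L' w\<close>; the
  lower metric bound for it concerns squares, whence \<open>sqrt K\<close>.\<close>

lemma speed_ge:
  assumes reg: "regular_at \<gamma> t" and u: "\<gamma> t = \<sigma> u" "u \<in> ball 0 r"
  obtains v where "((\<phi> \<circ> \<gamma>) has_vector_derivative v) (at t)" "norm v \<le> sqrt K * speed A g \<gamma> t"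
proof -
  have \<gamma>t: "\<gamma> t \<in> fst c" using u \<sigma>_in by simp
  then have "(snd c \<circ> \<gamma>) differentiable (at t)"
    using reg c unfolding regular_at_def by blast
  then obtain w where w: "((snd c \<circ> \<gamma>) has_vector_derivative w) (at t)"
    using vector_derivative_works by blast
  have "((\<lambda>t. (snd c \<circ> \<gamma>) t - z) has_vector_derivative w) (at t)"
    using has_vector_derivative_diff[OF w has_vector_derivative_const[of z]] by simp
  from bounded_linear.has_vector_derivative[OF _ this, of L'] L(2)
  have deriv: "((\<phi> \<circ> \<gamma>) has_vector_derivative L' w) (at t)"
    by (simp add: linear_linear \<phi>_def o_def)
  have "(norm (L' w))\<^sup>2 \<le> K * g c (\<gamma> t) w w"
    using ge[OF u(2), of "L' w"] by (simp add: L u(1) \<sigma>_def)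
  then have "norm (L' w) \<le> sqrt (K * g c (\<gamma> t) w w)"
    by (rule real_le_rsqrt)
  also have "\<dots> = sqrt K * speed A g \<gamma> t"
    using speed_in_chart[OF reg c \<gamma>t w] by (simp add: real_sqrt_mult)
  finally show thesis using that deriv by blast
qed

text \<open>The coordinate segment is one competitor for the infimum. Its chart velocity is the
  constant \<open>L (y - x)\<close>, and it stays where the upper metric bound holds.\<close>

lemma segment_length_le:
  assumes x: "x \<in> ball 0 (r / 5)" and y: "y \<in> ball 0 (r / 5)"
  shows "riemannian_dist T A g (\<sigma> x) (\<sigma> y) \<le> sqrt K * dist x y"
proof -
  let ?\<delta> = "\<lambda>t. inv_into (fst c) (snd c) ((z + L x) + t *\<^sub>R L (y - x))"
  have line: "(z + L x) + t *\<^sub>R L (y - x) = z + L (x + t *\<^sub>R (y - x))" for t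
    by (simp add: linear_add[OF L(1)] linear_scale[OF L(1)])
  have ball: "x + t *\<^sub>R (y - x) \<in> ball 0 r" if "t \<in> {-1<..<2}" for t
    using segment_in_ball[OF x y, of t] that by simp
  have \<delta>: "smooth_curve_in T A ?\<delta> {-1<..<2}"
  proof (rule smooth_curve_in_line[OF c])
    show "(z + L x) + t *\<^sub>R L (y - x) \<in> snd c ` fst c" if "t \<in> {-1<..<2}" for t
      unfolding line using V[OF ball[OF that]] .
  qed simp
  have "smooth_curve_on T A ?\<delta> 0 1"
    unfolding smooth_curve_on_iff using \<delta> by (intro exI[of _ ?\<delta>] exI[of _ 1]) simp
  then have "piecewise_smooth_curve T A ?\<delta> 0 1"
    unfolding piecewise_smooth_curve_def by (intro exI[of _ "1 :: nat"] exI[of _ real]) simp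
  then have "riemannian_dist T A g (\<sigma> x) (\<sigma> y) \<le> curve_length A g ?\<delta> 0 1"
    unfolding line by (intro riemannian_dist_le) (auto simp: \<sigma>_def)
  also have "\<dots> \<le> integral {0..1 :: real} (\<lambda>_. sqrt K * dist x y)"
    unfolding curve_length_def
  proof (rule integral_le)
    show "speed A g ?\<delta> integrable_on {0..1}"
      using continuous_on_speed[OF \<delta>] by (intro integrable_continuous_interval) (auto elim: continuous_on_subset)
    fix t :: real assume "t \<in> {0..1}"
    then have t: "t \<in> {-1<..<2}" by simp
    have reg: "regular_at ?\<delta> t"
      using \<delta> t by (rule smooth_curve_in_regular_at)
    have "((\<lambda>t. (z + L x) + t *\<^sub>R L (y - x)) has_vector_derivative L (y - x)) (at t)"
      by (auto intro!: derivative_eq_intros)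
    then have "((snd c \<circ> ?\<delta>) has_vector_derivative L (y - x)) (at t)"
    proof (rule has_vector_derivative_transform_within_open[OF _ open_greaterThanLessThan t])
      fix s :: real assume "s \<in> {-1<..<2}"
      then show "(z + L x) + s *\<^sub>R L (y - x) = (snd c \<circ> ?\<delta>) s"
        using f_inv_into_f[OF V[OF ball]] by (simp add: line)
    qed
    moreover have "?\<delta> t = \<sigma> (x + t *\<^sub>R (y - x))"
      by (simp add: line \<sigma>_def)
    moreover have "\<sigma> (x + t *\<^sub>R (y - x)) \<in> fst c"
      using ball[OF t] by (rule \<sigma>_in)
    ultimately have "speed A g ?\<delta> t = sqrt (g c (\<sigma> (x + t *\<^sub>R (y - x))) (L (y - x)) (L (y - x)))"
      using speed_in_chart[OF reg c] by simp
    also have "\<dots> \<le> sqrt (K * (norm (y - x))\<^sup>2)"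
      using le[OF ball[OF t]] by (simp add: \<sigma>_def)
    also have "\<dots> = sqrt K * dist x y"
      by (simp add: real_sqrt_mult dist_norm norm_minus_commute)
    finally show "speed A g ?\<delta> t \<le> sqrt K * dist x y" .
  qed (intro integrable_continuous_interval continuous_intros)
  finally show ?thesis by simp
qed

text \<open>The fundamental theorem of calculus in normal coordinates: the displacement of
  \<open>\<phi> \<circ> \<gamma>\<close> is at most the integral of its coordinate speed, which
  \<open>speed_ge\<close> bounds.\<close>

lemma curve_length_ge:
  assumes x: "x \<in> ball 0 (r / 5)" and y: "y \<in> ball 0 (r / 5)"
    and ab: "a < b" and \<gamma>: "\<gamma> a = \<sigma> x" "\<gamma> b = \<sigma> y" "admissible \<gamma> a b"
  shows "dist x y \<le> sqrt K * curve_length A g \<gamma> a b"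
proof -
  let ?R = "dist x y"
  \<comment> \<open>Such points have norm at most \<open>2 * norm x + norm y\<close>, which is below
    \<open>3 * r / 5\<close>.\<close>
  have R: "cball x ?R \<subseteq> ball 0 r"
  proof
    fix u assume "u \<in> cball x ?R"
    then have "dist x u \<le> dist x 0 + dist y 0"
      using dist_triangle2[of x y 0] by simp
    moreover have "dist 0 u \<le> dist x 0 + dist x u"
      using dist_triangle[of 0 u x] by (simp add: dist_commute)
    moreover have "5 * dist x 0 < r" "5 * dist y 0 < r" "0 \<le> dist x 0"
      using x y by (simp_all add: dist_commute)
    ultimately have "dist 0 u < r"
      by linarith
    then show "u \<in> ball 0 r"
      by simp
  qed
  text \<open>The curve is only followed up to the first time \<open>e\<close> at which it leaves the open ball of radius
    \<open>dist x y\<close> about \<open>x\<close>; this part stays in the chart and already has the required length.\<close>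
  define O' where "O' = \<sigma> ` ball x ?R"
  have "openin T O'"
    unfolding O'_def using R by (intro openin_\<sigma>) auto
  \<comment> \<open>Closedness makes the infimum of these times an actual first exit time;
    \<open>b\<close> is among them because \<open>y\<close> lies on the sphere.\<close>
  then have E_closed: "closed {t \<in> {a..b}. \<gamma> t \<in> topspace T - O'}" (is "closed ?E")
    by (intro admissibleD(2)[OF \<gamma>(3)] closedin_diff closedin_topspace)
  have b_E: "b \<in> ?E"
  proof -
    have yr: "y \<in> ball 0 r" using y by simp (use norm_ge_zero[of y] in linarith)
    have "\<sigma> y \<notin> O'"
    proof
      assume "\<sigma> y \<in> O'"
      then obtain u where u: "u \<in> ball x ?R" "\<sigma> y = \<sigma> u" by (auto simp: O'_def)
      then have "y = u"
        using \<phi>_\<sigma>[OF yr] \<phi>_\<sigma>[of u] R by (metis ball_subset_cball subsetD)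
      then show False using u(1) by simp
    qed
    moreover have "\<sigma> y \<in> topspace T"
      using \<sigma>_in[OF yr] chartD(6)[OF c] by blast
    ultimately show ?thesis
      using ab \<gamma>(2) by simp
  qed
  define e where "e = Inf ?E"
  have bdd: "bdd_below ?E"
    by (rule bdd_belowI[of _ a]) simp
  have e: "e \<in> ?E"
    unfolding e_def using b_E by (intro closed_contains_Inf bdd E_closed) blast
  have before: "\<gamma> t \<in> O'" if "a \<le> t" "t < e" for t
  proof (rule ccontr)
    assume "\<gamma> t \<notin> O'"
    moreover have "t \<in> {a..b}" using that e by simp
    moreover have "\<gamma> t \<in> topspace T"
      using \<gamma>(3) \<open>t \<in> {a..b}\<close> by (rule admissibleD)
    ultimately have "e \<le> t"
      unfolding e_def using bdd by (intro cInf_lower) auto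
    then show False using that by simp
  qed
  \<comment> \<open>At \<open>e\<close> itself this follows by passing to the limit from the left,
    since the image of the compact ball is closed.\<close>
  have C: "\<exists>u\<in>cball x ?R. \<gamma> t = \<sigma> u" if t: "t \<in> {a..e}" for t
  proof (cases "t = e")
    case False
    then have "\<gamma> t \<in> O'" using t before by simp
    then show ?thesis by (auto simp: O'_def)
  next
    case True
    show ?thesis
    proof (cases "a = e")
      \<comment> \<open>Happens only for \<open>x = y\<close>, when the open ball is empty.\<close>
      case True
      then show ?thesis using \<open>t = e\<close> \<gamma>(1) by (intro bexI[of _ x]) auto
    next
      case False
      have "closed {t \<in> {a..b}. \<gamma> t \<in> \<sigma> ` cball x ?R}" (is "closed ?F")
        using \<gamma>(3) closedin_\<sigma>[OF compact_cball R] by (rule admissibleD)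
      moreover have "{a<..<e} \<subseteq> ?F"
      proof
        fix s assume s: "s \<in> {a<..<e}"
        then have "\<gamma> s \<in> O'" using before by simp
        then have "\<gamma> s \<in> \<sigma> ` cball x ?R" by (auto simp: O'_def)
        then show "s \<in> ?F" using s e by simp
      qed
      ultimately have "closure {a<..<e} \<subseteq> ?F"
        by (rule closure_minimal[rotated])
      moreover have "a < e" using e False by simp
      then have "e \<in> closure {a<..<e}"
        by simp
      ultimately have "e \<in> ?F" by blast
      then show ?thesis using \<open>t = e\<close> by auto
    qed
  qed
  let ?f = "\<phi> \<circ> \<gamma>"
  have f: "?f t \<in> cball x ?R \<and> \<gamma> t = \<sigma> (?f t)" if t: "t \<in> {a..e}" for t
  proof -
    obtain u where "u \<in> cball x ?R" "\<gamma> t = \<sigma> u" using C[OF t] by blast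
    then show ?thesis using \<phi>_\<sigma> R by (metis comp_apply subsetD)
  qed
  have ae: "a \<le> e" "e \<le> b" using e by auto
  \<comment> \<open>Cutting a closed set \<open>B\<close> down to the compact ball makes its image
    closed in \<open>T\<close>, so its preimage under the curve is closed.\<close>
  have cont: "continuous_on {a..e} ?f"
  proof (subst continuous_on_closed_vimage; safe?)
    fix B :: "(real ^ 'n) set" assume "closed B"
    then have "compact (cball x ?R \<inter> B)" by (simp add: compact_Int_closed)
    then have "closedin T (\<sigma> ` (cball x ?R \<inter> B))"
      using R by (intro closedin_\<sigma>) auto
    with \<gamma>(3) have cl: "closed {t \<in> {a..b}. \<gamma> t \<in> \<sigma> ` (cball x ?R \<inter> B)}"
      by (rule admissibleD)
    have "?f -` B \<inter> {a..e} = {t \<in> {a..b}. \<gamma> t \<in> \<sigma> ` (cball x ?R \<inter> B)} \<inter> {a..e}"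
    proof (intro equalityI subsetI)
      fix t assume t: "t \<in> ?f -` B \<inter> {a..e}"
      then have "?f t \<in> cball x ?R \<inter> B" "\<gamma> t = \<sigma> (?f t)" using f by blast+
      then have "\<gamma> t \<in> \<sigma> ` (cball x ?R \<inter> B)" by (rule rev_image_eqI)
      then show "t \<in> {t \<in> {a..b}. \<gamma> t \<in> \<sigma> ` (cball x ?R \<inter> B)} \<inter> {a..e}"
        using t ae by auto
    next
      fix t assume t: "t \<in> {t \<in> {a..b}. \<gamma> t \<in> \<sigma> ` (cball x ?R \<inter> B)} \<inter> {a..e}"
      then obtain u where "u \<in> cball x ?R" "u \<in> B" "\<gamma> t = \<sigma> u" by blast
      then have "?f t = u" using \<phi>_\<sigma> R by (metis comp_apply subsetD)
      then show "t \<in> ?f -` B \<inter> {a..e}" using t \<open>u \<in> B\<close> by simp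
    qed
    then show "closed (?f -` B \<inter> {a..e})"
      using cl by (simp add: closed_Int)
  qed simp
  obtain S where S: "finite S" "\<And>t. t \<in> {a<..<b} - S \<Longrightarrow> regular_at \<gamma> t"
    using admissibleD(4)[OF \<gamma>(3)] by auto
  \<comment> \<open>The value \<open>0\<close> at exceptional times keeps the norm bound valid
    everywhere, as the speed is nonnegative; the fundamental theorem tolerates finitely many such
    times.\<close>
  define f' where "f' t = (if t \<in> {a<..<e} - S then vector_derivative ?f (at t) else 0)" for t
  have f': "(?f has_vector_derivative f' t) (at t) \<and> norm (f' t) \<le> sqrt K * speed A g \<gamma> t"
    if t: "t \<in> {a<..<e} - S" for t
  proof -
    have "regular_at \<gamma> t" using S(2) t ae by simp
    moreover have "\<gamma> t = \<sigma> (?f t)" "?f t \<in> ball 0 r"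
    proof -
      have "t \<in> {a..e}" using t by simp
      from f[OF this] show "\<gamma> t = \<sigma> (?f t)" "?f t \<in> ball 0 r" using R by blast+
    qed
    ultimately obtain v where v: "(?f has_vector_derivative v) (at t)" "norm v \<le> sqrt K * speed A g \<gamma> t"
      by (rule speed_ge)
    then have "f' t = v"
      using t by (simp add: f'_def vector_derivative_at)
    then show ?thesis using v by simp
  qed
  have speed0: "0 \<le> speed A g \<gamma> t" if "t \<in> {a..b}" for t
    using admissibleD(1)[OF \<gamma>(3) that] by (rule speed_nonneg)
  have int: "speed A g \<gamma> integrable_on {a..b}"
    using \<gamma>(3) by (rule admissibleD)
  then have int_e: "speed A g \<gamma> integrable_on {a..e}"
    by (rule integrable_on_subinterval) (use ae in auto)
  have ftc: "(f' has_integral (?f e - ?f a)) {a..e}"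
    using S(1) ae(1) _ cont by (rule fundamental_theorem_of_calculus_interior_strong) (use f' in blast)
  have fa: "?f a = x"
  proof -
    have "x \<in> ball 0 r" using R by (rule subsetD) simp
    then show ?thesis using \<phi>_\<sigma> \<gamma>(1) by simp
  qed
  have "?f e \<notin> ball x ?R"
  proof
    assume "?f e \<in> ball x ?R"
    moreover have "\<gamma> e = \<sigma> (?f e)" using f[of e] ae(1) by (simp only: atLeastAtMost_iff order_refl)
    ultimately have "\<gamma> e \<in> O'" unfolding O'_def by (rule rev_image_eqI)
    then show False using e by simp
  qed
  then have "?R \<le> norm (?f e - ?f a)"
    unfolding fa by (simp add: dist_norm norm_minus_commute)
  also have "\<dots> = norm (integral {a..e} f')"
    using ftc by (simp add: integral_unique)
  also have "\<dots> \<le> integral {a..e} (\<lambda>t. sqrt K * speed A g \<gamma> t)"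
  proof (rule Henstock_Kurzweil_Integration.integral_norm_bound_integral)
    show "f' integrable_on {a..e}" using ftc by blast
    show "(\<lambda>t. sqrt K * speed A g \<gamma> t) integrable_on {a..e}"
      using int_e by (rule integrable_on_mult_right)
    show "norm (f' t) \<le> sqrt K * speed A g \<gamma> t" if t: "t \<in> {a..e}" for t
    proof (cases "t \<in> {a<..<e} - S")
      case True
      then show ?thesis using f' by blast
    next
      case False
      then have "f' t = 0" unfolding f'_def by (rule if_not_P)
      then show ?thesis using speed0[of t] t ae K by simp
    qed
  qed
  also have "\<dots> = sqrt K * integral {a..e} (speed A g \<gamma>)"
    by simp
  \<comment> \<open>The part of the curve after \<open>e\<close> can only add length.\<close>
  also have "\<dots> \<le> sqrt K * integral {a..b} (speed A g \<gamma>)"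
    using int int_e speed0 ae K by (intro mult_left_mono integral_subset_le) auto
  finally show ?thesis
    by (simp add: curve_length_def)
qed

lemma ex_approximately_similar_copy:
  fixes S :: "(real ^ 'n) set"
  assumes "connected_space T" "0 < r" "finite S"
  shows "\<exists>f t. 0 < t \<and> inj_on f S \<and> f ` S \<subseteq> topspace T \<and>
    (\<forall>x\<in>S. \<forall>y\<in>S. t * dist x y \<le> riemannian_dist T A g (f x) (f y) \<and>
      riemannian_dist T A g (f x) (f y) \<le> K * t * dist x y)"
proof -
  obtain B where B: "0 < B" "\<And>x. x \<in> S \<Longrightarrow> norm x < B"
    using finite_imp_bounded[OF assms(3)] bounded_pos_less by blast
  \<comment> \<open>The homothety with this factor moves points of norm below \<open>B\<close> into
    the ball of radius \<open>r / 5\<close>.\<close>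
  define s where "s = r / (5 * B)"
  have s: "0 < s" using B assms(2) by (simp add: s_def)
  have small: "s *\<^sub>R x \<in> ball 0 (r / 5)" if "x \<in> S" for x
    using B(1) B(2)[OF that] assms(2) by (simp add: s_def field_simps)
  have in_ball: "s *\<^sub>R x \<in> ball 0 r" if "x \<in> S" for x
    using small[OF that] assms(2) by simp
  define f where "f x = \<sigma> (s *\<^sub>R x)" for x
  \<comment> \<open>Distances lie between \<open>s / sqrt K\<close> and \<open>sqrt K * s\<close>
    times the Euclidean ones; with this \<open>t\<close> the bounds are \<open>t\<close> and
    \<open>K * t\<close>.\<close>
  define t where "t = s / sqrt K"
  have "inj_on f S"
  proof (rule inj_onI)
    fix x y assume "x \<in> S" "y \<in> S" "f x = f y"
    then have "s *\<^sub>R x = s *\<^sub>R y"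
      using \<phi>_\<sigma>[OF in_ball] unfolding f_def by metis
    then show "x = y" using s by simp
  qed
  moreover have f_top: "f x \<in> topspace T" if "x \<in> S" for x
    using \<sigma>_in[OF in_ball[OF that]] chartD(6)[OF c] unfolding f_def by blast
  moreover have "0 < t"
    using s K by (simp add: t_def)
  moreover have scaled: "dist (s *\<^sub>R x) (s *\<^sub>R y) = s * dist x y" for x y :: "real ^ 'n"
    using s by (simp add: dist_norm flip: scaleR_diff_right)
  have "t * dist x y \<le> riemannian_dist T A g (f x) (f y)" if "x \<in> S" "y \<in> S" for x y
  proof (rule riemannian_dist_ge)
    show "joinable (f x) (f y)"
      using assms(1) f_top that by (intro connected_joinable)
    fix \<gamma> a b assume "a < b" "\<gamma> a = f x" "\<gamma> b = f y" "admissible \<gamma> a b"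
    then have "s * dist x y \<le> sqrt K * curve_length A g \<gamma> a b"
      using curve_length_ge[OF small[OF that(1)] small[OF that(2)]] unfolding f_def scaled by simp
    then show "t * dist x y \<le> curve_length A g \<gamma> a b"
      using K by (simp add: t_def field_simps)
  qed
  moreover have "riemannian_dist T A g (f x) (f y) \<le> K * t * dist x y" if "x \<in> S" "y \<in> S" for x y
  proof -
    have "K * t = sqrt K * s"
      using K by (simp add: t_def field_simps)
    then show ?thesis
      using segment_length_le[OF small[OF that(1)] small[OF that(2)]]
      unfolding f_def scaled by (simp add: mult_ac)
  qed
  ultimately show ?thesis
    by (intro exI[of _ f] exI[of _ t]) auto
qed

end

theorem theorem1p1:
  fixes T :: "'a topology"
    and A :: "('a, 'n::finite) chart set"
    and g :: "('a, 'n) chart \<Rightarrow> 'a \<Rightarrow> real ^ 'n \<Rightarrow> real ^ 'n \<Rightarrow> real"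
  assumes "riemannian_manifold T A g"
    and "connected_space T"
  shows "steiner_ratio (topspace T) (riemannian_dist T A g)
       \<le> steiner_ratio (UNIV :: (real ^ 'n) set) dist"
proof -
  interpret riemannian_manifold T A g by fact
  show ?thesis
  proof (rule steiner_ratio_mono_approx_similar)
    show "0 \<le> riemannian_dist T A g x y" if "x \<in> topspace T" "y \<in> topspace T" for x y
      using assms(2) that by (intro riemannian_dist_nonneg connected_joinable)
    show "\<exists>N :: (real ^ 'n) set. finite N \<and> N \<subseteq> UNIV \<and> 2 \<le> card N"
      \<comment> \<open>The index type is nonempty, so there is a coordinate vector, and it differs
        from \<open>0\<close>.\<close>
      by (intro exI[of _ "{0, axis undefined 1}"]) (simp add: axis_eq_0_iff)
    fix S :: "(real ^ 'n) set" and K :: real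
    assume "finite S" "1 < K"
    \<comment> \<open>Any point of the manifold serves as the centre; the radius \<open>r\<close> is
      then obtained for the given \<open>K\<close>.\<close>
    obtain c p where "c \<in> A" "p \<in> fst c"
      using nonempty cover by auto
    then obtain L L' r where "riemannian_normal_chart T A g c (snd c p) L L' r K" and "0 < r"
      using ex_normal_chart \<open>1 < K\<close> by blast
    then interpret riemannian_normal_chart T A g c "snd c p" L L' r K by simp
    show "\<exists>f t. 0 < t \<and> inj_on f S \<and> f ` S \<subseteq> topspace T \<and>
      (\<forall>x\<in>S. \<forall>y\<in>S. t * dist x y \<le> riemannian_dist T A g (f x) (f y) \<and>
        riemannian_dist T A g (f x) (f y) \<le> K * t * dist x y)"
      using assms(2) \<open>0 < r\<close> \<open>finite S\<close> by (rule ex_approximately_similar_copy)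
  qed simp_all
qed

end
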